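(* Let $k\ge 2$. The set $S_\beta=\{\beta_0,\beta_1,\ldots,\beta_{k-2},\tau\}\subset \mathrm{Aut}\,X^{[k]}$, where $\beta_i=\alpha_i$ for $0\le i\le k-2$, is a minimal generating set of the group $G_k$, and $G_k$ is isomorphic to a Sylow 2-subgroup of the alternating group $A_{2^k}$.
   Context: $X^{[k]}$ is the rooted binary tree with levels $X^0,X^1,\ldots,X^k$. Level $X^j$ consists of $2^j$ vertices $v_{j,1},\ldots,v_{j,2^j}$ numbered from left to right, so the children of $v_{j,i}$ ($j<k$) are $v_{j+1,2i-1}$ and $v_{j+1,2i}$. An automorphism $g\in\mathrm{Aut}\,X^{[k]}$ (fixing the root) is determined by its portrait: for every vertex $v_{j,i}$ with $0\le j\le k-1$, if $g(v_{j,i})=v_{j,m}$, then the state (vertex permutation) of $g$ at $v_{j,i}$ is trivial (label 0) if $g(v_{j+1,2i-1})=v_{j+1,2m-1}$, and non-trivial, or active (label 1), if $g(v_{j+1,2i-1})=v_{j+1,2m}$. Any assignment of labels to the vertices of levels $0,\ldots,k-1$ is the portrait of a unique automorphism. For $0\le l\le k-2$, $\alpha_l=\beta_l$ is the automorphism whose only active state is at $v_{l,1}$. The automorphism $\tau=\tau_{1,2^{k-1}}$ has active states exactly at $v_{k-1,1}$ and $v_{k-1,2^{k-1}}$. $G_k$ is the subgroup of $\mathrm{Aut}\,X^{[k]}$ consisting of all automorphisms that act on the $2^k$ vertices of $X^k$ by even permutations. A generating set is minimal if no proper subset of it generates the group. *)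

theory Defs
  imports "HOL-Algebra.Sym_Groups" "HOL-Computational_Algebra.Primes"
begin

section \<open>The rooted binary tree\<close>

text \<open>The vertex \<open>v\<^sub>j\<^sub>,\<^sub>i\<close> is the pair \<open>(j, i)\<close>; positions \<open>i\<close> start at 1, so that
  the truncated subtraction in \<open>left_child\<close> is exact on vertices.\<close>

type_synonym vertex = "nat \<times> nat"

definition tree_level :: "nat \<Rightarrow> vertex set" where
  "tree_level j = {j} \<times> {1..2 ^ j}"

definition tree_vertices :: "nat \<Rightarrow> vertex set" where
  "tree_vertices k = (\<Union>j\<le>k. tree_level j)"

definition inner_vertices :: "nat \<Rightarrow> vertex set" where
  "inner_vertices k = (\<Union>j<k. tree_level j)"

definition tree_root :: vertex where
  "tree_root = (0, 1)"

fun left_child :: "vertex \<Rightarrow> vertex" where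
  "left_child (j, i) = (j + 1, 2 * i - 1)"

fun right_child :: "vertex \<Rightarrow> vertex" where
  "right_child (j, i) = (j + 1, 2 * i)"

definition is_child :: "vertex \<Rightarrow> vertex \<Rightarrow> bool" where
  "is_child u v \<longleftrightarrow> v = left_child u \<or> v = right_child u"

definition tree_adj :: "vertex \<Rightarrow> vertex \<Rightarrow> bool" where
  "tree_adj u v \<longleftrightarrow> is_child u v \<or> is_child v u"


section \<open>Automorphisms and portraits\<close>

text \<open>As usual for \<open>permutes\<close>, an automorphism is extended by the identity outside the
  vertex set.\<close>

definition tree_auts :: "nat \<Rightarrow> (vertex \<Rightarrow> vertex) set" where
  "tree_auts k = {g. g permutes tree_vertices k \<and> g tree_root = tree_root \<and>
     (\<forall>u\<in>tree_vertices k. \<forall>v\<in>tree_vertices k. tree_adj (g u) (g v) \<longleftrightarrow> tree_adj u v)}"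

definition tree_aut_group :: "nat \<Rightarrow> (vertex \<Rightarrow> vertex) monoid" where
  "tree_aut_group k = \<lparr>carrier = tree_auts k, mult = (\<circ>), one = id\<rparr>"

definition active :: "(vertex \<Rightarrow> vertex) \<Rightarrow> vertex \<Rightarrow> bool" where
  "active g v \<longleftrightarrow> g (left_child v) = right_child (g v)"

definition active_vertices :: "nat \<Rightarrow> (vertex \<Rightarrow> vertex) \<Rightarrow> vertex set" where
  "active_vertices k g = {v \<in> inner_vertices k. active g v}"

text \<open>Existence and uniqueness, for \<open>A \<subseteq> inner_vertices k\<close>, are proved in
  \<open>portrait_unique\<close> below.\<close>

definition aut_of_portrait :: "nat \<Rightarrow> vertex set \<Rightarrow> (vertex \<Rightarrow> vertex)" where
  "aut_of_portrait k A = (THE g. g \<in> tree_auts k \<and> active_vertices k g = A)"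


section \<open>The group and its generators\<close>

definition even_tree_auts :: "nat \<Rightarrow> (vertex \<Rightarrow> vertex) set" where
  "even_tree_auts k = {g \<in> tree_auts k. evenperm (restrict_id g (tree_level k))}"

definition even_tree_group :: "nat \<Rightarrow> (vertex \<Rightarrow> vertex) monoid" where
  "even_tree_group k = (tree_aut_group k)\<lparr>carrier := even_tree_auts k\<rparr>"

definition beta :: "nat \<Rightarrow> nat \<Rightarrow> (vertex \<Rightarrow> vertex)" where
  "beta k l = aut_of_portrait k {(l, 1)}"

definition tau :: "nat \<Rightarrow> (vertex \<Rightarrow> vertex)" where
  "tau k = aut_of_portrait k {(k - 1, 1), (k - 1, 2 ^ (k - 1))}"

definition S_beta :: "nat \<Rightarrow> (vertex \<Rightarrow> vertex) set" where
  "S_beta k = beta k ` {0..k - 2} \<union> {tau k}"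


section \<open>Minimal generating sets and Sylow subgroups\<close>

definition minimal_generating_set :: "('a, 'b) monoid_scheme \<Rightarrow> 'a set \<Rightarrow> bool" where
  "minimal_generating_set G S \<longleftrightarrow> S \<subseteq> carrier G \<and> generate G S = carrier G \<and>
     (\<forall>T. T \<subset> S \<longrightarrow> generate G T \<noteq> carrier G)"

definition sylow_subgroup :: "nat \<Rightarrow> ('a, 'b) monoid_scheme \<Rightarrow> 'a set \<Rightarrow> bool" where
  "sylow_subgroup p G P \<longleftrightarrow> prime p \<and> finite (carrier G) \<and> subgroup P G \<and>
     card P = p ^ multiplicity p (order G)"


section \<open>Well-definedness of portraits\<close>

fun tree_parent :: "vertex \<Rightarrow> vertex" where
  "tree_parent (j, i) = (j - 1, (i + 1) div 2)"

lemma mem_tree_level: "(j, i) \<in> tree_level l \<longleftrightarrow> j = l \<and> 1 \<le> i \<and> i \<le> 2 ^ j"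
  by (auto simp: tree_level_def)

lemma mem_tree_vertices: "(j, i) \<in> tree_vertices k \<longleftrightarrow> j \<le> k \<and> 1 \<le> i \<and> i \<le> 2 ^ j"
  by (auto simp: tree_vertices_def mem_tree_level)

lemma mem_inner_vertices: "(j, i) \<in> inner_vertices k \<longleftrightarrow> j < k \<and> 1 \<le> i \<and> i \<le> 2 ^ j"
  by (auto simp: inner_vertices_def mem_tree_level)

lemma is_child_iff_parent:
  assumes "u \<in> tree_vertices k" "v \<in> tree_vertices k"
  shows "is_child u v \<longleftrightarrow> 0 < fst v \<and> u = tree_parent v"
proof -
  obtain j i where u: "u = (j, i)" by (cases u)
  obtain m n where v: "v = (m, n)" by (cases v)
  have "1 \<le> i" "1 \<le> n" using assms by (auto simp: u v mem_tree_vertices)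
  then show ?thesis unfolding u v is_child_def by (auto; presburger)
qed

lemma parent_in_vertices:
  assumes "v \<in> tree_vertices k" "0 < fst v"
  shows "tree_parent v \<in> tree_vertices k"
proof -
  obtain j i where v: "v = (Suc j, i)" using assms(2) by (cases v) (auto elim: less_natE)
  show ?thesis using assms(1) by (auto simp: v mem_tree_vertices)
qed

lemma children_in_vertices:
  assumes "v \<in> inner_vertices k"
  shows "v \<in> tree_vertices k" "left_child v \<in> tree_vertices k" "right_child v \<in> tree_vertices k"
  using assms by (cases v; auto simp: mem_inner_vertices mem_tree_vertices)+

lemma tree_auts_level_parent:
  assumes g: "g \<in> tree_auts k" and v: "v \<in> tree_vertices k"
  shows "fst (g v) = fst v \<and> (0 < fst v \<longrightarrow> tree_parent (g v) = g (tree_parent v))"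
  using v
proof (induction "fst v" arbitrary: v)
  case 0
  then have "v = tree_root" by (cases v) (auto simp: mem_tree_vertices tree_root_def)
  then show ?case using g by (simp add: tree_auts_def tree_root_def)
next
  case (Suc j)
  let ?p = "tree_parent v"
  have pm: "g permutes tree_vertices k" using g by (simp add: tree_auts_def)
  have pV: "?p \<in> tree_vertices k" using Suc parent_in_vertices by simp
  have pj: "fst ?p = j" using Suc(2) by (cases v) auto
  have IH: "fst (g ?p) = j" "0 < j \<Longrightarrow> tree_parent (g ?p) = g (tree_parent ?p)"
    using Suc(1)[of ?p] pV pj by auto
  have gV: "g v \<in> tree_vertices k" "g ?p \<in> tree_vertices k"
    using pm Suc(3) pV by (simp_all add: permutes_in_image)
  have "is_child ?p v" using is_child_iff_parent[OF pV Suc(3)] Suc(2) by simp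
  then have "tree_adj (g ?p) (g v)"
    using g pV Suc(3) unfolding tree_auts_def tree_adj_def by blast
  then show ?case unfolding tree_adj_def
  proof
    assume "is_child (g ?p) (g v)"
    then have "0 < fst (g v)" "g ?p = tree_parent (g v)"
      using is_child_iff_parent gV by blast+
    moreover from this have "fst (g v) = Suc j"
      using IH(1) by (cases "g v") auto
    ultimately show ?thesis using Suc(2) by simp
  next
    assume "is_child (g v) (g ?p)"
    then have *: "0 < j" "g v = tree_parent (g ?p)"
      using is_child_iff_parent gV IH(1) by blast+
    then have "g v = g (tree_parent ?p)" using IH by simp
    then have "v = tree_parent ?p" using permutes_inj[OF pm] by (simp add: inj_eq)
    then have "fst v = j - 1" using pj by (cases ?p) auto
    then show ?thesis using Suc(2) by simp
  qed
qed

lemma tree_auts_in_inner: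
  assumes "g \<in> tree_auts k" "v \<in> inner_vertices k"
  shows "g v \<in> inner_vertices k"
proof -
  have "g v \<in> tree_vertices k" using assms children_in_vertices(1)
    by (auto simp: tree_auts_def permutes_in_image)
  moreover have "fst (g v) = fst v"
    using tree_auts_level_parent[OF assms(1) children_in_vertices(1)[OF assms(2)]] by simp
  ultimately show ?thesis using assms(2)
    by (cases v; cases "g v") (auto simp: mem_inner_vertices mem_tree_vertices)
qed

lemma tree_auts_children:
  assumes g: "g \<in> tree_auts k" and v: "v \<in> inner_vertices k"
  shows "g (left_child v) = (if active g v then right_child (g v) else left_child (g v))"
    and "g (right_child v) = (if active g v then left_child (g v) else right_child (g v))"
proof -
  have pm: "g permutes tree_vertices k" using g by (simp add: tree_auts_def)
  note V = children_in_vertices[OF v]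
  obtain j i where ji: "v = (j, i)" by (cases v)
  have i: "1 \<le> i" using v by (simp add: ji mem_inner_vertices)
  have gch: "g c = left_child (g v) \<or> g c = right_child (g v)"
    if c: "c = left_child v \<or> c = right_child v" for c
  proof -
    have "is_child v c" using c by (simp add: is_child_def)
    have cV: "c \<in> tree_vertices k" using c V by auto
    have "0 < fst c" "tree_parent c = v"
      using is_child_iff_parent[OF V(1) cV] \<open>is_child v c\<close> by auto
    then have "0 < fst (g c)" "tree_parent (g c) = g v"
      using tree_auts_level_parent[OF g cV] by auto
    moreover have "g v \<in> tree_vertices k" "g c \<in> tree_vertices k"
      using pm V cV by (simp_all add: permutes_in_image)
    ultimately have "is_child (g v) (g c)" using is_child_iff_parent by auto
    then show ?thesis by (simp add: is_child_def)
  qed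
  have "left_child v \<noteq> right_child v" using i by (simp add: ji)
  then have "g (left_child v) \<noteq> g (right_child v)"
    using permutes_inj[OF pm] by (simp add: inj_eq)
  then show "g (left_child v) = (if active g v then right_child (g v) else left_child (g v))"
    and "g (right_child v) = (if active g v then left_child (g v) else right_child (g v))"
    using gch[of "left_child v"] gch[of "right_child v"] unfolding active_def by auto
qed

lemma vertex_cases:
  assumes "v \<in> tree_vertices k"
  shows "v = tree_root \<or> (\<exists>u\<in>inner_vertices k. fst v = Suc (fst u) \<and> is_child u v)"
proof (cases "0 < fst v")
  case True
  then obtain j i where v: "v = (Suc j, i)" by (cases v) (auto elim: less_natE)
  have "tree_parent v \<in> inner_vertices k"
    using assms by (auto simp: v mem_tree_vertices mem_inner_vertices)
  moreover have "is_child (tree_parent v) v"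
    using is_child_iff_parent[OF parent_in_vertices[OF assms True] assms] True by simp
  moreover have "fst v = Suc (fst (tree_parent v))" by (simp add: v)
  ultimately show ?thesis by blast
next
  case False
  then show ?thesis using assms by (cases v) (auto simp: mem_tree_vertices tree_root_def)
qed

lemma portrait_inj:
  assumes g: "g \<in> tree_auts k" and h: "h \<in> tree_auts k"
    and eq: "active_vertices k g = active_vertices k h"
  shows "g = h"
proof
  fix v
  have act: "active g u = active h u" if "u \<in> inner_vertices k" for u
    using eq that unfolding active_vertices_def by blast
  have in_V: "g v = h v" if "v \<in> tree_vertices k" for v
    using that
  proof (induction "fst v" arbitrary: v rule: less_induct)
    case less
    from vertex_cases[OF less(2)] show ?case
    proof
      assume "v = tree_root"
      then show ?thesis using g h by (simp add: tree_auts_def)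
    next
      assume "\<exists>u\<in>inner_vertices k. fst v = Suc (fst u) \<and> is_child u v"
      then obtain u where u: "u \<in> inner_vertices k" "fst v = Suc (fst u)" "is_child u v"
        by blast
      have "g u = h u" using less(1)[of u] u children_in_vertices(1) by simp
      then show ?thesis
        using u(3) tree_auts_children[OF g u(1)] tree_auts_children[OF h u(1)] act[OF u(1)]
        unfolding is_child_def by auto
    qed
  qed
  show "g v = h v"
    using in_V g h by (cases "v \<in> tree_vertices k") (auto simp: tree_auts_def permutes_not_in)
qed

primrec portrait_pos :: "vertex set \<Rightarrow> nat \<Rightarrow> nat \<Rightarrow> nat" where
  "portrait_pos A 0 i = 1"
| "portrait_pos A (Suc j) i =
     (if odd i = ((j, (i + 1) div 2) \<in> A) then 2 * portrait_pos A j ((i + 1) div 2)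
      else 2 * portrait_pos A j ((i + 1) div 2) - 1)"

lemma half_range:
  fixes i :: nat
  assumes "1 \<le> i" "i \<le> 2 ^ Suc j"
  shows "1 \<le> (i + 1) div 2" "(i + 1) div 2 \<le> 2 ^ j"
  using assms by auto

lemma portrait_pos_range:
  "1 \<le> i \<Longrightarrow> i \<le> 2 ^ j \<Longrightarrow> 1 \<le> portrait_pos A j i \<and> portrait_pos A j i \<le> 2 ^ j"
proof (induction j arbitrary: i)
  case (Suc j)
  define m where "m = portrait_pos A j ((i + 1) div 2)"
  have "1 \<le> m" "m \<le> 2 ^ j"
    using Suc.IH[OF half_range[OF Suc.prems]] by (simp_all add: m_def)
  moreover have "portrait_pos A (Suc j) i = 2 * m \<or> portrait_pos A (Suc j) i = 2 * m - 1"
    unfolding portrait_pos.simps m_def by argo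
  ultimately show ?case unfolding power_Suc by linarith
qed simp

lemma portrait_pos_parent:
  assumes "1 \<le> i" "i \<le> 2 ^ Suc j"
  shows "(portrait_pos A (Suc j) i + 1) div 2 = portrait_pos A j ((i + 1) div 2)"
proof -
  define m where "m = portrait_pos A j ((i + 1) div 2)"
  have "1 \<le> m" using portrait_pos_range half_range[OF assms] by (simp add: m_def)
  moreover have "portrait_pos A (Suc j) i = 2 * m \<or> portrait_pos A (Suc j) i = 2 * m - 1"
    unfolding portrait_pos.simps m_def by argo
  ultimately show ?thesis unfolding m_def[symmetric] by presburger
qed

lemma portrait_pos_inj: "inj_on (portrait_pos A j) {1..2 ^ j}"
proof (induction j)
  case (Suc j)
  show ?case
  proof (rule inj_onI)
    fix x y assume "x \<in> {1..2 ^ Suc j}" "y \<in> {1..2 ^ Suc j}"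
      and eq: "portrait_pos A (Suc j) x = portrait_pos A (Suc j) y"
    then have x: "1 \<le> x" "x \<le> 2 ^ Suc j" and y: "1 \<le> y" "y \<le> 2 ^ Suc j"
      unfolding atLeastAtMost_iff by blast+
    define p where "p = (x + 1) div 2"
    define m where "m = portrait_pos A j p"
    have "portrait_pos A j ((x + 1) div 2) = portrait_pos A j ((y + 1) div 2)"
      using portrait_pos_parent[OF x, of A] portrait_pos_parent[OF y, of A] eq by argo
    then have p: "(y + 1) div 2 = p"
      using inj_onD[OF Suc, of "(x + 1) div 2" "(y + 1) div 2"] half_range[OF x] half_range[OF y]
      unfolding p_def atLeastAtMost_iff by argo
    have "1 \<le> m"
      using portrait_pos_range half_range[OF x] by (simp add: m_def p_def)
    then have "2 * m \<noteq> 2 * m - 1" by arith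
    then have "odd x = odd y"
      using eq unfolding portrait_pos.simps p p_def[symmetric] m_def[symmetric] by argo
    then show "x = y" using p unfolding p_def by presburger
  qed
qed simp

definition portrait_map :: "nat \<Rightarrow> vertex set \<Rightarrow> vertex \<Rightarrow> vertex" where
  "portrait_map k A v = (if v \<in> tree_vertices k then (fst v, portrait_pos A (fst v) (snd v)) else v)"

lemma portrait_map_in:
  assumes "v \<in> tree_vertices k" shows "portrait_map k A v \<in> tree_vertices k"
  using assms portrait_pos_range[of "snd v" "fst v" A]
  by (cases v) (auto simp: portrait_map_def mem_tree_vertices)

lemma finite_tree_vertices: "finite (tree_vertices k)"
  by (simp add: tree_vertices_def tree_level_def)

lemma portrait_map_permutes: "portrait_map k A permutes tree_vertices k"
proof (rule bij_imp_permutes)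
  have "inj_on (portrait_map k A) (tree_vertices k)"
    using inj_onD[OF portrait_pos_inj]
    by (intro inj_onI) (auto simp: portrait_map_def mem_tree_vertices)
  moreover have "portrait_map k A ` tree_vertices k \<subseteq> tree_vertices k"
    using portrait_map_in by blast
  ultimately show "bij_betw (portrait_map k A) (tree_vertices k) (tree_vertices k)"
    unfolding bij_betw_def using endo_inj_surj[OF finite_tree_vertices] by blast
qed (simp add: portrait_map_def)

lemma portrait_map_child:
  assumes u: "u \<in> tree_vertices k" and v: "v \<in> tree_vertices k"
  shows "is_child (portrait_map k A u) (portrait_map k A v) \<longleftrightarrow> is_child u v"
proof -
  let ?f = "portrait_map k A"
  have fst: "fst (?f v) = fst v" by (simp add: portrait_map_def)
  have par: "tree_parent (?f v) = ?f (tree_parent v)" if pos: "0 < fst v"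
  proof -
    obtain j i where ji: "v = (Suc j, i)" using pos by (cases v) (auto elim: less_natE)
    have "1 \<le> i" "i \<le> 2 ^ Suc j" using v by (auto simp: ji mem_tree_vertices)
    moreover have "tree_parent v \<in> tree_vertices k" using parent_in_vertices v pos by simp
    ultimately show ?thesis using v portrait_pos_parent[of i j A]
      by (simp add: portrait_map_def ji del: portrait_pos.simps)
  qed
  have "is_child (?f u) (?f v) \<longleftrightarrow> 0 < fst v \<and> ?f u = ?f (tree_parent v)"
    using is_child_iff_parent[OF portrait_map_in[OF u] portrait_map_in[OF v]] fst par by auto
  also have "\<dots> \<longleftrightarrow> 0 < fst v \<and> u = tree_parent v"
    using permutes_inj[OF portrait_map_permutes] by (auto simp: inj_eq)
  also have "\<dots> \<longleftrightarrow> is_child u v" using is_child_iff_parent[OF u v] by simp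
  finally show ?thesis .
qed

lemma portrait_map_aut: "portrait_map k A \<in> tree_auts k"
proof -
  have "portrait_map k A tree_root = tree_root"
    by (simp add: portrait_map_def tree_root_def)
  then show ?thesis
    using portrait_map_permutes portrait_map_child by (simp add: tree_auts_def tree_adj_def)
qed

lemma portrait_map_active:
  assumes "A \<subseteq> inner_vertices k"
  shows "active_vertices k (portrait_map k A) = A"
proof -
  have "active (portrait_map k A) v \<longleftrightarrow> v \<in> A" if v: "v \<in> inner_vertices k" for v
  proof -
    obtain j i where ji: "v = (j, i)" by (cases v)
    have i: "1 \<le> i" "i \<le> 2 ^ j" using v by (auto simp: ji mem_inner_vertices)
    have m: "1 \<le> portrait_pos A j i" using portrait_pos_range[OF i] by simp
    have odd: "odd (2 * i - 1)" using i by presburger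
    have "Suc (2 * i - 1) div 2 = i" using i by simp
    then show ?thesis
      using children_in_vertices[OF v] m odd
      unfolding active_def ji by (auto simp: portrait_map_def)
  qed
  then show ?thesis using assms unfolding active_vertices_def by auto
qed

theorem portrait_unique:
  assumes "A \<subseteq> inner_vertices k"
  shows "\<exists>!g. g \<in> tree_auts k \<and> active_vertices k g = A"
  using portrait_map_aut portrait_map_active[OF assms] portrait_inj by (intro ex1I) blast+

corollary aut_of_portrait:
  assumes "A \<subseteq> inner_vertices k"
  shows "aut_of_portrait k A \<in> tree_auts k" "active_vertices k (aut_of_portrait k A) = A"
  using theI'[OF portrait_unique[OF assms]] unfolding aut_of_portrait_def by auto


section \<open>The automorphisms form a group, the even ones a subgroup\<close>

lemma tree_auts_inv:
  assumes "g \<in> tree_auts k"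
  shows "inv' g \<in> tree_auts k"
proof -
  have pm: "g permutes tree_vertices k" using assms by (simp add: tree_auts_def)
  have gi: "g (inv' g v) = v" for v using permutes_inverses(1)[OF pm] .
  have iV: "inv' g v \<in> tree_vertices k" if "v \<in> tree_vertices k" for v
    using permutes_in_image[OF permutes_inv[OF pm]] that by blast
  have root: "inv' g tree_root = tree_root"
    using assms permutes_inv_eq[OF pm] by (auto simp: tree_auts_def)
  have "tree_adj (inv' g u) (inv' g v) \<longleftrightarrow> tree_adj u v"
    if "u \<in> tree_vertices k" "v \<in> tree_vertices k" for u v
  proof -
    have "tree_adj (g (inv' g u)) (g (inv' g v)) \<longleftrightarrow> tree_adj (inv' g u) (inv' g v)"
      using assms iV that by (simp add: tree_auts_def)
    then show ?thesis by (simp add: gi)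
  qed
  then show ?thesis using permutes_inv[OF pm] root by (simp add: tree_auts_def)
qed

lemma tree_auts_comp:
  assumes "g \<in> tree_auts k" "h \<in> tree_auts k"
  shows "g \<circ> h \<in> tree_auts k"
  using assms by (auto simp: tree_auts_def permutes_compose permutes_in_image)

lemma id_in_tree_auts: "id \<in> tree_auts k"
  by (simp add: tree_auts_def permutes_id)

lemma tree_aut_group_is_group: "group (tree_aut_group k)"
proof (rule groupI)
  fix g assume "g \<in> carrier (tree_aut_group k)"
  then have g: "g \<in> tree_auts k" by (simp add: tree_aut_group_def)
  then have "inv' g \<circ> g = id" by (auto simp: tree_auts_def intro: permutes_inv_o(2))
  then show "\<exists>h\<in>carrier (tree_aut_group k). h \<otimes>\<^bsub>tree_aut_group k\<^esub> g = \<one>\<^bsub>tree_aut_group k\<^esub>"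
    using tree_auts_inv[OF g] by (auto simp: tree_aut_group_def)
qed (auto simp: tree_aut_group_def tree_auts_comp id_in_tree_auts comp_assoc)

lemma restrict_level_permutes:
  assumes g: "g \<in> tree_auts k"
  shows "restrict_id g (tree_level k) permutes tree_level k"
    and "v \<in> tree_level k \<Longrightarrow> g v \<in> tree_level k"
proof -
  have pm: "g permutes tree_vertices k" using g by (simp add: tree_auts_def)
  have lev: "g v \<in> tree_level k" if "v \<in> tree_level k" for v
  proof -
    have V: "v \<in> tree_vertices k" using that by (auto simp: tree_vertices_def)
    have "fst (g v) = fst v" using tree_auts_level_parent[OF g V] by simp
    moreover have "g v \<in> tree_vertices k" using pm V by (simp add: permutes_in_image)
    ultimately show ?thesis using that
      by (cases v; cases "g v") (auto simp: mem_tree_vertices mem_tree_level)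
  qed
  then show "v \<in> tree_level k \<Longrightarrow> g v \<in> tree_level k" .
  have "finite (tree_level k)" by (simp add: tree_level_def)
  then have "g ` tree_level k = tree_level k"
    using lev permutes_inj_on[OF pm] by (intro endo_inj_surj) auto
  then have "bij_betw g (tree_level k) (tree_level k)"
    using permutes_inj_on[OF pm] by (simp add: bij_betw_def)
  then have "bij_betw (restrict_id g (tree_level k)) (tree_level k) (tree_level k)"
    by (rule bij_betw_restrict_id) simp
  then show "restrict_id g (tree_level k) permutes tree_level k"
    by (rule bij_imp_permutes) simp
qed

lemma restrict_level_comp:
  assumes "h \<in> tree_auts k"
  shows "restrict_id (g \<circ> h) (tree_level k)
    = restrict_id g (tree_level k) \<circ> restrict_id h (tree_level k)"
  using restrict_level_permutes(2)[OF assms] by (auto simp: restrict_id_def fun_eq_iff)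

lemma restrict_level_permutation:
  assumes "g \<in> tree_auts k"
  shows "permutation (restrict_id g (tree_level k))"
proof -
  have "finite (tree_level k)" by (simp add: tree_level_def)
  then show ?thesis
    using restrict_level_permutes(1)[OF assms] unfolding permutation_permutes by blast
qed

lemma even_tree_auts_subgroup: "subgroup (even_tree_auts k) (tree_aut_group k)"
proof (rule group.subgroupI[OF tree_aut_group_is_group])
  show "even_tree_auts k \<subseteq> carrier (tree_aut_group k)"
    by (auto simp: even_tree_auts_def tree_aut_group_def)
  have "restrict_id id (tree_level k) = id" by (auto simp: restrict_id_def)
  then have "id \<in> even_tree_auts k" by (simp add: even_tree_auts_def id_in_tree_auts)
  then show "even_tree_auts k \<noteq> {}" by blast
next
  fix g assume ge: "g \<in> even_tree_auts k"
  then have g: "g \<in> tree_auts k" by (simp add: even_tree_auts_def)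
  let ?r = "\<lambda>h. restrict_id h (tree_level k)"
  have gi: "inv' g \<circ> g = id" using g by (auto simp: tree_auts_def intro: permutes_inv_o(2))
  then have "inv\<^bsub>tree_aut_group k\<^esub> g = inv' g"
    using g tree_auts_inv[OF g]
    by (intro group.inv_equality[OF tree_aut_group_is_group]) (auto simp: tree_aut_group_def)
  moreover have "?r (inv' g) \<circ> ?r g = id"
    unfolding restrict_level_comp[OF g, symmetric] gi by (auto simp: restrict_id_def)
  then have "evenperm (?r (inv' g)) = evenperm (?r g)"
    using evenperm_comp[OF restrict_level_permutation[OF tree_auts_inv[OF g]]
        restrict_level_permutation[OF g]] by simp
  ultimately show "inv\<^bsub>tree_aut_group k\<^esub> g \<in> even_tree_auts k"
    using ge tree_auts_inv[OF g] by (simp add: even_tree_auts_def)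
next
  fix g h assume "g \<in> even_tree_auts k" "h \<in> even_tree_auts k"
  then have gh: "g \<in> tree_auts k" "h \<in> tree_auts k"
    "evenperm (restrict_id g (tree_level k))" "evenperm (restrict_id h (tree_level k))"
    by (auto simp: even_tree_auts_def)
  have "evenperm (restrict_id (g \<circ> h) (tree_level k))"
    unfolding restrict_level_comp[OF gh(2)]
    using evenperm_comp[OF gh(1,2)[THEN restrict_level_permutation]] gh(3,4) by blast
  then have "g \<circ> h \<in> even_tree_auts k"
    using tree_auts_comp[OF gh(1,2)] unfolding even_tree_auts_def by blast
  then show "g \<otimes>\<^bsub>tree_aut_group k\<^esub> h \<in> even_tree_auts k"
    by (simp add: tree_aut_group_def)
qed

end

theory Submission
  imports Defs
begin

text \<open>Write \<open>T\<^sub>A\<close> for the automorphism with active set \<open>A\<close>. If \<open>A\<close> lies in level \<open>l\<close> and \<open>g\<close> is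
  inactive from level \<open>l\<close> downwards, then \<open>g T\<^sub>A g\<inverse>\<close> has active set \<open>g A\<close>. Conjugating
  \<open>\<beta>\<^sub>l\<close> level by level therefore yields all \<open>T\<^sub>A\<close> with \<open>A\<close> a single vertex above level \<open>k - 1\<close>;
  conjugating \<open>\<tau>\<close> yields all \<open>T\<^sub>A\<close> with \<open>A\<close> a pair of vertices of level \<open>k - 1\<close> in opposite halves,
  and products of two of these give the remaining pairs. Since the sign of the action on the leaves is
  the number of active vertices of level \<open>k - 1\<close> modulo 2, these generate all even automorphisms.

  No generator is redundant: the number of active vertices modulo 2 in level \<open>l \<le> k - 2\<close>, and in
  the left half of level \<open>k - 1\<close>, are homomorphisms on the even automorphisms, each of which is
  nontrivial on exactly one generator. Finally, the \<open>2\<^sup>k - 1\<close> labels give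
  \<open>2 ^ (2\<^sup>k - 2)\<close> even automorphisms, which is the full power of 2 in \<open>(2\<^sup>k)! / 2\<close>.\<close>

section \<open>Truncated automorphisms\<close>

lemma tree_level_subset_inner: "l < k \<Longrightarrow> tree_level l \<subseteq> inner_vertices k"
  by (auto simp: inner_vertices_def)

lemma inner_vertices_iff: "v \<in> inner_vertices k \<longleftrightarrow> v \<in> tree_level (fst v) \<and> fst v < k"
  by (cases v) (auto simp: mem_inner_vertices mem_tree_level)

lemma tree_vertices_iff: "v \<in> tree_vertices k \<longleftrightarrow> v \<in> tree_level (fst v) \<and> fst v \<le> k"
  by (cases v) (auto simp: mem_tree_vertices mem_tree_level)

lemma tree_level_fst: "v \<in> tree_level l \<Longrightarrow> fst v = l"
  by (cases v) (auto simp: mem_tree_level)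

lemma finite_tree_level: "finite (tree_level l)"
  by (simp add: tree_level_def)

lemma children_neq: "v \<in> inner_vertices k \<Longrightarrow> left_child v \<noteq> right_child v"
  by (cases v) (auto simp: mem_inner_vertices)

lemma tree_auts_inj: "g \<in> tree_auts k \<Longrightarrow> inj g"
  by (auto simp: tree_auts_def intro: permutes_inj)

lemma tree_auts_fst: "g \<in> tree_auts k \<Longrightarrow> v \<in> tree_vertices k \<Longrightarrow> fst (g v) = fst v"
  using tree_auts_level_parent by blast

lemma tree_auts_in_level:
  assumes "g \<in> tree_auts k" "l \<le> k" "v \<in> tree_level l"
  shows "g v \<in> tree_level l"
proof -
  have v: "v \<in> tree_vertices k" using assms by (auto simp: tree_vertices_def)
  then have "g v \<in> tree_vertices k" using assms(1) by (auto simp: tree_auts_def permutes_in_image)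
  then show ?thesis
    using tree_auts_fst[OF assms(1) v] tree_level_fst[OF assms(3)] by (simp add: tree_vertices_iff)
qed

text \<open>The cocycle rule: \<open>h\<close> may reverse the children of \<open>v\<close>, and
  then \<open>g\<close> those of \<open>h v\<close>; two reversals cancel. So labels add modulo 2,
  with the label of \<open>g\<close> read at the moved vertex.\<close>

lemma active_comp:
  assumes g: "g \<in> tree_auts k" and h: "h \<in> tree_auts k" and v: "v \<in> inner_vertices k"
  shows "active (g \<circ> h) v \<longleftrightarrow> active g (h v) \<noteq> active h v"
proof -
  have hv: "h v \<in> inner_vertices k" using tree_auts_in_inner[OF h v] .
  show ?thesis
    using tree_auts_children[OF h v] tree_auts_children[OF g hv]
      children_neq[OF tree_auts_in_inner[OF g hv]]
    by (auto simp: active_def[of "g \<circ> h"])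
qed

lemma active_aut_of_portrait:
  assumes "A \<subseteq> inner_vertices k" "v \<in> inner_vertices k"
  shows "active (aut_of_portrait k A) v \<longleftrightarrow> v \<in> A"
  using aut_of_portrait(2)[OF assms(1)] assms(2) unfolding active_vertices_def by blast

lemma tree_auts_eqI:
  assumes "g \<in> tree_auts k" "h \<in> tree_auts k"
    and "\<And>v. v \<in> inner_vertices k \<Longrightarrow> active g v \<longleftrightarrow> active h v"
  shows "g = h"
  using assms by (intro portrait_inj[of g k h]) (auto simp: active_vertices_def)

lemma not_active_id: "v \<in> inner_vertices k \<Longrightarrow> \<not> active id v"
  using children_neq by (simp add: active_def)

text \<open>Induction down from the root: the image of a child is determined by the image and the
  label of its parent, and all labels above level \<open>l\<close> are 0.\<close>

lemma fixes_above_active: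
  assumes g: "g \<in> tree_auts k"
    and deep: "\<And>u. u \<in> inner_vertices k \<Longrightarrow> active g u \<Longrightarrow> l \<le> fst u"
    and v: "v \<in> tree_vertices k" "fst v \<le> l"
  shows "g v = v"
  using v
proof (induction "fst v" arbitrary: v rule: less_induct)
  case less
  from vertex_cases[OF less(2)] show ?case
  proof
    assume "v = tree_root"
    then show ?thesis using g by (simp add: tree_auts_def)
  next
    assume "\<exists>u\<in>inner_vertices k. fst v = Suc (fst u) \<and> is_child u v"
    then obtain u where u: "u \<in> inner_vertices k" "fst v = Suc (fst u)" "is_child u v"
      by blast
    have "g u = u" using less(1)[of u] less(3) u children_in_vertices(1) by simp
    moreover have "\<not> active g u" using deep[OF u(1)] less(3) u(2) by auto
    ultimately show ?thesis
      using u(3) tree_auts_children[OF g u(1)] unfolding is_child_def by auto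
  qed
qed

lemma portrait_fixes_above:
  assumes "l < k" "A \<subseteq> tree_level l" "v \<in> tree_vertices k" "fst v \<le> l"
  shows "aut_of_portrait k A v = v"
proof -
  have A: "A \<subseteq> inner_vertices k" using assms tree_level_subset_inner by blast
  show ?thesis
    using assms(2) tree_level_fst
    by (intro fixes_above_active[OF aut_of_portrait(1)[OF A] _ assms(3,4)])
      (auto simp: active_aut_of_portrait[OF A])
qed

text \<open>The right factor fixes level \<open>l\<close> pointwise, so both factors are read at the
  same vertices there and their labels simply add modulo 2.\<close>

lemma portrait_comp_level:
  assumes l: "l < k" and A: "A \<subseteq> tree_level l" and B: "B \<subseteq> tree_level l"
  shows "aut_of_portrait k A \<circ> aut_of_portrait k B = aut_of_portrait k ((A - B) \<union> (B - A))"
proof -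
  have C: "(A - B) \<union> (B - A) \<subseteq> tree_level l" using A B by blast
  have *: "A \<subseteq> inner_vertices k" "B \<subseteq> inner_vertices k" "(A - B) \<union> (B - A) \<subseteq> inner_vertices k"
    using A B C tree_level_subset_inner[OF l] by blast+
  show ?thesis
  proof (rule tree_auts_eqI)
    fix v assume v: "v \<in> inner_vertices k"
    \<comment> \<open>Applying the right factor keeps membership in \<open>A\<close>: vertices of
      level \<open>l\<close> are fixed and all others stay off that level.\<close>
    have "aut_of_portrait k B v = v" if "v \<in> tree_level l"
      using portrait_fixes_above[OF l B children_in_vertices(1)[OF v]] tree_level_fst[OF that]
      by simp
    moreover have "aut_of_portrait k B v \<notin> tree_level l" if "v \<notin> tree_level l"
      using that tree_auts_fst[OF aut_of_portrait(1)[OF *(2)] children_in_vertices(1)[OF v]] v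
      by (metis inner_vertices_iff tree_level_fst)
    ultimately have "aut_of_portrait k B v \<in> A \<longleftrightarrow> v \<in> A" using A by (metis subsetD)
    then show "active (aut_of_portrait k A \<circ> aut_of_portrait k B) v
        \<longleftrightarrow> active (aut_of_portrait k ((A - B) \<union> (B - A))) v"
      using active_comp[OF aut_of_portrait(1)[OF *(1)] aut_of_portrait(1)[OF *(2)] v]
        active_aut_of_portrait[OF *(1) tree_auts_in_inner[OF aut_of_portrait(1)[OF *(2)] v]]
        active_aut_of_portrait[OF *(2) v] active_aut_of_portrait[OF *(3) v]
      by blast
  qed (use *[THEN aut_of_portrait(1)] tree_auts_comp in blast)+
qed

lemma portrait_empty: "aut_of_portrait k {} = id"
  by (rule tree_auts_eqI[of _ k])
    (auto simp: aut_of_portrait id_in_tree_auts active_aut_of_portrait not_active_id)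

section \<open>Truncated automorphisms and conjugation of portraits\<close>

text \<open>For \<open>l \<le> k\<close> this is a copy of the automorphism group of the tree of
  depth \<open>l\<close>, moving the subtrees that hang from level \<open>l\<close> rigidly. It
  complements the pointwise stabilizer of that level.\<close>

definition truncated_auts :: "nat \<Rightarrow> nat \<Rightarrow> (vertex \<Rightarrow> vertex) set" where
  "truncated_auts k l = {g \<in> tree_auts k. active_vertices k g \<subseteq> inner_vertices l}"

lemma truncated_auts_iff:
  "g \<in> truncated_auts k l \<longleftrightarrow>
     g \<in> tree_auts k \<and> (\<forall>v\<in>inner_vertices k. l \<le> fst v \<longrightarrow> \<not> active g v)"
proof -
  have "v \<in> inner_vertices l \<longleftrightarrow> fst v < l" if "v \<in> inner_vertices k" for v
    using that by (simp add: inner_vertices_iff)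
  then show ?thesis
    unfolding truncated_auts_def active_vertices_def subset_iff mem_Collect_eq Ball_def
    by (meson not_le)
qed

lemma truncated_auts_comp:
  assumes "g \<in> truncated_auts k l" "h \<in> truncated_auts k l"
  shows "g \<circ> h \<in> truncated_auts k l"
  unfolding truncated_auts_iff
proof (intro conjI ballI impI)
  have gh: "g \<in> tree_auts k" "h \<in> tree_auts k" using assms by (auto simp: truncated_auts_iff)
  then show "g \<circ> h \<in> tree_auts k" by (rule tree_auts_comp)
  fix v assume v: "v \<in> inner_vertices k" "l \<le> fst v"
  then show "\<not> active (g \<circ> h) v"
    using assms tree_auts_fst[OF gh(2) children_in_vertices(1)[OF v(1)]]
      tree_auts_in_inner[OF gh(2) v(1)]
    by (auto simp: truncated_auts_iff active_comp[OF gh v(1)])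
qed

lemma truncated_auts_mono: "l \<le> m \<Longrightarrow> truncated_auts k l \<subseteq> truncated_auts k m"
  by (auto simp: truncated_auts_iff)

lemma portrait_truncated:
  assumes "l < m" "m \<le> k" "A \<subseteq> tree_level l"
  shows "aut_of_portrait k A \<in> truncated_auts k m"
proof -
  have A: "A \<subseteq> inner_vertices k" using assms tree_level_subset_inner[of l k] by auto
  show ?thesis
    using assms tree_level_fst
    by (fastforce simp: truncated_auts_iff aut_of_portrait[OF A] active_aut_of_portrait[OF A])
qed

text \<open>By the cocycle rule the labels of both sides at \<open>v\<close> are the label of
  \<open>g\<close> plus membership of \<open>v\<close> in \<open>A\<close>, respectively of
  \<open>g v\<close> in the image of \<open>A\<close>; these agree as \<open>g\<close> is injective.
  Stated as a commutation, so that no label of an inverse is needed.\<close>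

lemma conj_portrait:
  assumes l: "l < k" and g: "g \<in> truncated_auts k l" and A: "A \<subseteq> tree_level l"
  shows "g \<circ> aut_of_portrait k A = aut_of_portrait k (g ` A) \<circ> g"
proof -
  have g': "g \<in> tree_auts k" using g by (simp add: truncated_auts_iff)
  have gA: "g ` A \<subseteq> tree_level l" using tree_auts_in_level[OF g'] l A by auto
  have *: "A \<subseteq> inner_vertices k" "g ` A \<subseteq> inner_vertices k"
    using A gA tree_level_subset_inner[OF l] by blast+
  note T = aut_of_portrait(1)[OF *(1)] aut_of_portrait(1)[OF *(2)]
  show ?thesis
  proof (rule tree_auts_eqI)
    fix v assume v: "v \<in> inner_vertices k"
    note Tv = tree_auts_in_inner[OF T(1) v]
    \<comment> \<open>Down to level \<open>l\<close> the portrait moves nothing; below it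
      \<open>g\<close> has no active vertices, and levels are preserved.\<close>
    have "active g (aut_of_portrait k A v) = active g v"
    proof (cases "fst v \<le> l")
      case True
      then show ?thesis using portrait_fixes_above[OF l A children_in_vertices(1)[OF v]] by simp
    next
      case False
      then show ?thesis
        using g v Tv tree_auts_fst[OF T(1) children_in_vertices(1)[OF v]]
        by (simp add: truncated_auts_iff)
    qed
    then show "active (g \<circ> aut_of_portrait k A) v \<longleftrightarrow> active (aut_of_portrait k (g ` A) \<circ> g) v"
      using tree_auts_in_inner[OF g' v] tree_auts_inj[OF g']
      by (auto simp: active_comp[OF g' T(1) v] active_comp[OF T(2) g' v]
          active_aut_of_portrait * v inj_image_mem_iff)
  qed (auto simp: g' T tree_auts_comp)
qed

section \<open>Generation\<close>

lemma tree_aut_subgroup: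
  assumes "subgroup H (tree_aut_group k)"
  shows "H \<subseteq> tree_auts k" "id \<in> H" "\<And>g h. g \<in> H \<Longrightarrow> h \<in> H \<Longrightarrow> g \<circ> h \<in> H"
    "\<And>g. g \<in> H \<Longrightarrow> inv' g \<in> H"
proof -
  show H: "H \<subseteq> tree_auts k" using subgroup.subset[OF assms] by (simp add: tree_aut_group_def)
  show "id \<in> H" using subgroup.one_closed[OF assms] by (simp add: tree_aut_group_def)
  show "g \<circ> h \<in> H" if "g \<in> H" "h \<in> H" for g h
    using subgroup.m_closed[OF assms that] by (simp add: tree_aut_group_def)
  fix g assume g: "g \<in> H"
  then have "g \<in> tree_auts k" using H by blast
  then have "inv\<^bsub>tree_aut_group k\<^esub> g = inv' g"
    using tree_auts_inv[of g k]
    by (intro group.inv_equality[OF tree_aut_group_is_group])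
      (auto simp: tree_aut_group_def tree_auts_def intro: permutes_inv_o(2))
  then show "inv' g \<in> H" using subgroup.m_inv_closed[OF assms g] by simp
qed

lemma portrait_level_involution:
  assumes "l < k" "A \<subseteq> tree_level l"
  shows "aut_of_portrait k A \<circ> aut_of_portrait k A = id"
  using portrait_comp_level[OF assms assms(2)] by (simp add: portrait_empty)

text \<open>The right factor fixes level \<open>l\<close> pointwise, so it cancels exactly the
  labels of \<open>g\<close> there; deeper down both factors are inactive.\<close>

lemma truncated_auts_remove_level:
  assumes l: "l < k" and g: "g \<in> truncated_auts k (Suc l)"
  shows "g \<circ> aut_of_portrait k {v \<in> tree_level l. active g v} \<in> truncated_auts k l"
proof -
  let ?B = "{v \<in> tree_level l. active g v}"
  have B: "?B \<subseteq> tree_level l" by blast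
  then have B': "?B \<subseteq> inner_vertices k" using tree_level_subset_inner[OF l] by blast
  note T = aut_of_portrait(1)[OF B']
  have g': "g \<in> tree_auts k" using g by (simp add: truncated_auts_iff)
  have "\<not> active (g \<circ> aut_of_portrait k ?B) v"
    if v: "v \<in> inner_vertices k" and lv: "l \<le> fst v" for v
  proof (cases "fst v = l")
    case True
    then have "v \<in> tree_level l" using v by (simp add: inner_vertices_iff)
    then show ?thesis
      using portrait_fixes_above[OF l B children_in_vertices(1)[OF v]] True
      by (simp add: active_comp[OF g' T v] active_aut_of_portrait[OF B' v])
  next
    case False
    then have "Suc l \<le> fst v" "v \<notin> ?B" using lv tree_level_fst[of v l] by auto
    then show ?thesis
      using g v tree_auts_in_inner[OF T v] tree_auts_fst[OF T children_in_vertices(1)[OF v]]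
      by (simp add: active_comp[OF g' T v] active_aut_of_portrait[OF B' v] truncated_auts_iff)
  qed
  then show ?thesis using tree_auts_comp[OF g' T] by (simp add: truncated_auts_iff)
qed

text \<open>Peels the lowest level off \<open>g\<close>: its portrait is an involution, so
  \<open>g\<close> is an element truncated one level higher times that portrait. This serves both
  the induction over the levels and the last inner level of an even automorphism.\<close>

lemma mem_subgroup_of_level:
  assumes H: "subgroup H (tree_aut_group k)" and l: "l < k" and g: "g \<in> truncated_auts k (Suc l)"
    and trunc: "truncated_auts k l \<subseteq> H"
    and level: "aut_of_portrait k {v \<in> tree_level l. active g v} \<in> H"
  shows "g \<in> H"
proof -
  let ?T = "aut_of_portrait k {v \<in> tree_level l. active g v}"
  have "?T \<circ> ?T = id" using portrait_level_involution[OF l] by simp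
  then have "g = (g \<circ> ?T) \<circ> ?T" by (simp add: comp_assoc)
  also have "\<dots> \<in> H"
    using tree_aut_subgroup(3)[OF H] truncated_auts_remove_level[OF l g] trunc level by blast
  finally show ?thesis .
qed

lemma portrait_in_subgroup:
  assumes H: "subgroup H (tree_aut_group k)" and l: "l < k"
    and single: "\<And>v. v \<in> tree_level l \<Longrightarrow> aut_of_portrait k {v} \<in> H"
    and B: "B \<subseteq> tree_level l"
  shows "aut_of_portrait k B \<in> H"
  using finite_subset[OF B finite_tree_level] B
proof (induction B rule: finite_induct)
  case empty
  show ?case unfolding portrait_empty by (rule tree_aut_subgroup(2)[OF H])
next
  case (insert v B)
  have "({v} - B) \<union> (B - {v}) = insert v B" using insert by blast
  then have "aut_of_portrait k {v} \<circ> aut_of_portrait k B = aut_of_portrait k (insert v B)"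
    using portrait_comp_level[OF l, of "{v}" B] insert by simp
  then show ?case using insert single tree_aut_subgroup(3)[OF H] by (metis insert_subset)
qed

text \<open>Induction on \<open>l\<close>, splitting off the lowest level each time; single vertices
  of a level multiply up to every portrait on it.\<close>

lemma truncated_auts_subset_subgroup:
  assumes H: "subgroup H (tree_aut_group k)" and "l \<le> k"
    and single: "\<And>v. v \<in> inner_vertices l \<Longrightarrow> aut_of_portrait k {v} \<in> H"
  shows "truncated_auts k l \<subseteq> H"
  using assms(2,3)
proof (induction l)
  case 0
  have "g = id" if "g \<in> truncated_auts k 0" for g
    using that
    by (intro tree_auts_eqI[of _ k]) (auto simp: truncated_auts_iff id_in_tree_auts not_active_id)
  then show ?case using tree_aut_subgroup(2)[OF H] by blast
next
  case (Suc l)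
  have "truncated_auts k l \<subseteq> H" using Suc by (simp add: inner_vertices_iff)
  moreover have "aut_of_portrait k {v \<in> tree_level l. active g v} \<in> H" for g
    by (rule portrait_in_subgroup[OF H, of l]) (use Suc.prems in \<open>auto simp: inner_vertices_def\<close>)
  ultimately show ?case
    using mem_subgroup_of_level[OF H] Suc.prems(1) Suc_le_lessD by blast
qed

section \<open>Transitivity on levels and conjugates of the generators\<close>

lemma level_Suc_cases:
  assumes "w \<in> tree_level (Suc l)"
  obtains p where "p \<in> tree_level l" "w = left_child p \<or> w = right_child p"
proof -
  have "w \<in> tree_vertices (Suc l)" using assms by (auto simp: tree_vertices_def)
  from vertex_cases[OF this] tree_level_fst[OF assms] that show ?thesis
    by (auto simp: tree_root_def is_child_def inner_vertices_iff)
qed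

lemma conj_portrait_in_subgroup:
  assumes H: "subgroup H (tree_aut_group k)" and l: "l < k"
    and g: "g \<in> truncated_auts k l" "g \<in> H"
    and A: "A \<subseteq> tree_level l" "aut_of_portrait k A \<in> H"
  shows "aut_of_portrait k (g ` A) \<in> H"
proof -
  have "g \<circ> inv' g = id"
    using g(1) by (auto simp: truncated_auts_iff tree_auts_def intro: permutes_inv_o(1))
  then have "aut_of_portrait k (g ` A) = g \<circ> aut_of_portrait k A \<circ> inv' g"
    unfolding conj_portrait[OF l g(1) A(1)] by (simp add: comp_assoc)
  then show ?thesis using tree_aut_subgroup[OF H] g A by simp
qed

text \<open>An element taking \<open>(l, 1)\<close> to the parent \<open>p\<close> of the target is
  followed, if needed, by the swap of the children of \<open>p\<close>, which is a conjugate of the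
  generator at \<open>(l, 1)\<close> and so lies in \<open>H\<close>. Truncation is carried along
  because \<open>conj_portrait\<close> requires it.\<close>

lemma level_transitive:
  assumes H: "subgroup H (tree_aut_group k)" and n: "n < k"
    and gens: "\<And>l. l < n \<Longrightarrow> aut_of_portrait k {(l, 1)} \<in> H"
  shows "l \<le> n \<Longrightarrow> v \<in> tree_level l \<Longrightarrow> \<exists>g\<in>H \<inter> truncated_auts k l. g (l, 1) = v"
proof (induction l arbitrary: v)
  case 0
  then have "v = (0, 1)" by (cases v) (auto simp: mem_tree_level)
  moreover have "id \<in> truncated_auts k 0"
    by (simp add: truncated_auts_iff id_in_tree_auts not_active_id)
  ultimately show ?case using tree_aut_subgroup(2)[OF H] by (intro bexI[of _ id]) auto
next
  case (Suc l)
  obtain p where p: "p \<in> tree_level l" and v: "v = left_child p \<or> v = right_child p"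
    using level_Suc_cases[OF Suc.prems(2)] .
  obtain g where g: "g \<in> H" "g \<in> truncated_auts k l" "g (l, 1) = p"
    using Suc.IH[OF _ p] Suc.prems by auto
  have l: "l < k" "l < n" using Suc.prems n by auto
  have g': "g \<in> tree_auts k" "g \<in> truncated_auts k (Suc l)"
    using g(2) truncated_auts_mono[of l "Suc l"] by (auto simp: truncated_auts_iff)
  have l1: "(l, 1) \<in> inner_vertices k" "{(l, 1)} \<subseteq> tree_level l" and pk: "p \<in> inner_vertices k"
    using l p tree_level_subset_inner[OF l(1)] by (auto simp: mem_inner_vertices mem_tree_level)
  \<comment> \<open>\<open>g\<close> is inactive at \<open>(l, 1)\<close>, so the leftmost vertex
    below it goes to a left child.\<close>
  have gl: "g (Suc l, 1) = left_child p"
    using tree_auts_children(1)[OF g'(1) l1(1)] g l1(1) by (auto simp: truncated_auts_iff)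
  let ?T = "aut_of_portrait k {p}"
  have T: "?T \<in> H" using conj_portrait_in_subgroup[OF H l(1) g(2,1) l1(2)] gens[OF l(2)] g by simp
  have T': "?T \<in> truncated_auts k (Suc l)" using portrait_truncated[of l "Suc l" k "{p}"] p l by simp
  have "?T (left_child p) = right_child p"
    using tree_auts_children(1)[of ?T k p] aut_of_portrait(1)[of "{p}" k]
      active_aut_of_portrait[of "{p}" k p] pk portrait_fixes_above[of l k "{p}" p]
      l p children_in_vertices(1)[OF pk] tree_level_fst[OF p] by simp
  then have "(?T \<circ> g) (Suc l, 1) = right_child p" using gl by simp
  moreover have "?T \<circ> g \<in> H \<inter> truncated_auts k (Suc l)"
    using tree_aut_subgroup(3)[OF H T g(1)] truncated_auts_comp[OF T' g'(2)] by blast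
  ultimately show ?case using v gl g(1) g'(2) by blast
qed

lemma single_portrait_in_subgroup:
  assumes H: "subgroup H (tree_aut_group k)" and n: "n < k"
    and gens: "\<And>l. l < n \<Longrightarrow> aut_of_portrait k {(l, 1)} \<in> H"
    and v: "v \<in> inner_vertices n"
  shows "aut_of_portrait k {v} \<in> H"
proof -
  obtain l where l: "l < n" "v \<in> tree_level l" using v by (auto simp: inner_vertices_def)
  then obtain g where g: "g \<in> H" "g \<in> truncated_auts k l" "g (l, 1) = v"
    using level_transitive[OF H n gens, of l v] by auto
  moreover have "{(l, 1)} \<subseteq> tree_level l" by (auto simp: mem_tree_level)
  ultimately show ?thesis
    using conj_portrait_in_subgroup[OF H _ g(2,1), of "{(l, 1)}"] l n gens by simp
qed

section \<open>Pairs of vertices on the last inner level\<close>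

text \<open>From level 1 on, this says that \<open>v\<close> lies below or at the left child of the
  root. At the root the truncated exponent makes it true, hence the assumption
  \<open>1 \<le> l\<close> in its lemmas.\<close>

definition left_half :: "vertex \<Rightarrow> bool" where
  "left_half v \<longleftrightarrow> snd v \<le> 2 ^ (fst v - 1)"

lemma left_half_child:
  assumes "p \<in> tree_level l" "1 \<le> l"
  shows "left_half (left_child p) \<longleftrightarrow> left_half p" "left_half (right_child p) \<longleftrightarrow> left_half p"
proof -
  obtain m i where "l = Suc m" "p = (Suc m, i)"
    using assms by (cases p; cases l) (auto simp: mem_tree_level)
  then show "left_half (left_child p) \<longleftrightarrow> left_half p" "left_half (right_child p) \<longleftrightarrow> left_half p"
    by (auto simp: left_half_def)
qed

text \<open>Vertices in opposite halves have distinct ancestors on every level from 1 on, so the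
  labels steering one end to \<open>u\<close> and the other to \<open>w\<close> can be chosen
  independently. On level 1 each half is a single vertex and the identity suffices.\<close>

lemma halves_transitive:
  assumes "l < k"
  shows "1 \<le> l \<Longrightarrow> u \<in> tree_level l \<Longrightarrow> w \<in> tree_level l \<Longrightarrow> left_half u \<Longrightarrow> \<not> left_half w \<Longrightarrow>
    \<exists>g\<in>truncated_auts k l. g (l, 1) = u \<and> g (l, 2 ^ l) = w"
  using assms
proof (induction l arbitrary: u w)
  case (Suc l)
  show ?case
  proof (cases "l = 0")
    case True
    then have "u = (1, 1)" "w = (1, 2)"
      using Suc.prems by (cases u; cases w; auto simp: mem_tree_level left_half_def)+
    then show ?thesis using True
      by (intro bexI[of _ id]) (auto simp: truncated_auts_iff id_in_tree_auts not_active_id)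
  next
    case False
    then have l: "1 \<le> l" "l < k" using Suc.prems by auto
    obtain p where p: "p \<in> tree_level l" and u: "u = left_child p \<or> u = right_child p"
      using level_Suc_cases[OF Suc.prems(2)] .
    obtain q where q: "q \<in> tree_level l" and w: "w = left_child q \<or> w = right_child q"
      using level_Suc_cases[OF Suc.prems(3)] .
    have half: "left_half p" "\<not> left_half q"
      using left_half_child[OF p l(1)] left_half_child[OF q l(1)] u w Suc.prems by auto
    then have "p \<noteq> q" by blast
    obtain g where g: "g \<in> truncated_auts k l" "g (l, 1) = p" "g (l, 2 ^ l) = q"
      using Suc.IH[OF l(1) p q half l(2)] by blast
    have g': "g \<in> tree_auts k" "g \<in> truncated_auts k (Suc l)"
      using g(1) truncated_auts_mono[of l "Suc l"] by (auto simp: truncated_auts_iff)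
    have ends: "(l, 1) \<in> inner_vertices k" "(l, 2 ^ l) \<in> inner_vertices k"
      using l by (auto simp: mem_inner_vertices)
    have gl: "g (Suc l, 1) = left_child p"
      using tree_auts_children(1)[OF g'(1) ends(1)] g ends by (auto simp: truncated_auts_iff)
    have gr: "g (Suc l, 2 ^ Suc l) = right_child q"
      using tree_auts_children(2)[OF g'(1) ends(2)] g ends by (auto simp: truncated_auts_iff)
    have pq: "p \<in> inner_vertices k" "q \<in> inner_vertices k"
      using p q tree_level_subset_inner[OF l(2)] by auto
    \<comment> \<open>\<open>g\<close> brings the two ends to \<open>left_child p\<close> and
      \<open>right_child q\<close>; a label is set exactly where the wanted target is the other
      sibling.\<close>
    define A where "A = (if u = right_child p then {p} else {}) \<union> (if w = left_child q then {q} else {})"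
    have A: "A \<subseteq> tree_level l" "A \<subseteq> inner_vertices k" using p q pq by (auto simp: A_def)
    let ?T = "aut_of_portrait k A"
    note T = aut_of_portrait(1)[OF A(2)]
    have T': "?T \<in> truncated_auts k (Suc l)" using portrait_truncated[OF _ _ A(1)] l by simp
    have Tfix: "?T p = p" "?T q = q"
      using portrait_fixes_above[OF l(2) A(1)] p q children_in_vertices(1)[OF pq(1)]
        children_in_vertices(1)[OF pq(2)] tree_level_fst[OF p] tree_level_fst[OF q] by simp_all
    have act: "active ?T p \<longleftrightarrow> u = right_child p" "active ?T q \<longleftrightarrow> w = left_child q"
      using active_aut_of_portrait[OF A(2)] pq \<open>p \<noteq> q\<close> by (auto simp: A_def)
    have "?T (left_child p) = u" "?T (right_child q) = w"
      using tree_auts_children(1)[OF T pq(1)] tree_auts_children(2)[OF T pq(2)] Tfix act u w by auto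
    then have "(?T \<circ> g) (Suc l, 1) = u" "(?T \<circ> g) (Suc l, 2 ^ Suc l) = w"
      using gl gr by (simp_all del: power_Suc)
    then show ?thesis using truncated_auts_comp[OF T' g'(2)] by blast
  qed
qed simp

lemma pair_portrait_in_subgroup:
  assumes H: "subgroup H (tree_aut_group k)" and l: "1 \<le> l" "l < k"
    and trunc: "truncated_auts k l \<subseteq> H"
    and tau: "aut_of_portrait k {(l, 1), (l, 2 ^ l)} \<in> H"
    and u: "u \<in> tree_level l" and w: "w \<in> tree_level l" and "u \<noteq> w"
  shows "aut_of_portrait k {u, w} \<in> H"
proof -
  have ends: "(l, 1) \<in> tree_level l" "(l, 2 ^ l) \<in> tree_level l" by (auto simp: mem_tree_level)
  have halves: "left_half (l, 1)" "\<not> left_half (l, 2 ^ l)"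
    using l by (cases l; simp add: left_half_def)+
  have opposite: "aut_of_portrait k {x, y} \<in> H"
    if xy: "x \<in> tree_level l" "y \<in> tree_level l" "left_half x" "\<not> left_half y" for x y
  proof -
    obtain g where g: "g \<in> truncated_auts k l" "g (l, 1) = x" "g (l, 2 ^ l) = y"
      using halves_transitive[OF l(2,1) xy] by blast
    then have "g \<in> H" using trunc by blast
    then show ?thesis
      using conj_portrait_in_subgroup[OF H l(2) g(1) _ _ tau] ends g by simp
  qed
  have via: "aut_of_portrait k {x, y} \<in> H"
    if "z \<in> tree_level l" "x \<in> tree_level l" "y \<in> tree_level l" "x \<noteq> y" "x \<noteq> z" "y \<noteq> z"
      "aut_of_portrait k {x, z} \<in> H" "aut_of_portrait k {z, y} \<in> H" for x y z
  proof -
    have "({x, z} - {z, y}) \<union> ({z, y} - {x, z}) = {x, y}" using that by blast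
    then have "aut_of_portrait k {x, z} \<circ> aut_of_portrait k {z, y} = aut_of_portrait k {x, y}"
      using portrait_comp_level[OF l(2), of "{x, z}" "{z, y}"] that by simp
    then show ?thesis using tree_aut_subgroup(3)[OF H] that by metis
  qed
  have opposite': "aut_of_portrait k {x, y} \<in> H"
    if "x \<in> tree_level l" "y \<in> tree_level l" "left_half x \<noteq> left_half y" for x y
    using opposite[of x y] opposite[of y x] that by (auto simp: insert_commute)
  \<comment> \<open>One of the two ends of the level, in the half opposite to \<open>u\<close>. If
    \<open>u\<close> and \<open>w\<close> share a half, \<open>z\<close> links them and cancels in
    the symmetric difference of \<open>{u, z}\<close> and \<open>{z, w}\<close>.\<close>
  obtain z where z: "z \<in> tree_level l" "left_half z \<noteq> left_half u"
    using ends halves by blast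
  show ?thesis
  proof (cases "left_half u = left_half w")
    case True
    then have "u \<noteq> z" "w \<noteq> z" using z by auto
    then show ?thesis
      using via[OF z(1) u w \<open>u \<noteq> w\<close>] opposite'[OF u z(1)] opposite'[OF z(1) w] z True by simp
  next
    case False
    then show ?thesis using opposite'[OF u w] by simp
  qed
qed

lemma even_portrait_in_subgroup:
  assumes H: "subgroup H (tree_aut_group k)" and l: "l < k"
    and pair: "\<And>u w. u \<in> tree_level l \<Longrightarrow> w \<in> tree_level l \<Longrightarrow> u \<noteq> w \<Longrightarrow>
      aut_of_portrait k {u, w} \<in> H"
    and B: "B \<subseteq> tree_level l" "even (card B)"
  shows "aut_of_portrait k B \<in> H"
  using B
proof (induction "card B" arbitrary: B rule: less_induct)
  case less
  have fin: "finite B" using finite_subset[OF less(2) finite_tree_level] .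
  show ?case
  proof (cases "B = {}")
    case True
    then show ?thesis using portrait_empty tree_aut_subgroup(2)[OF H] by simp
  next
    case False
    then have "2 \<le> card B" using less(3) fin by (cases "card B" rule: nat.exhaust) (auto, presburger)
    then obtain C where "C \<subseteq> B" "card C = 2" by (meson obtain_subset_with_card_n)
    then obtain u w where uw: "u \<in> B" "w \<in> B" "u \<noteq> w" by (auto simp: card_2_iff)
    let ?C = "B - {u, w}"
    have "card ?C = card B - 2" using uw fin by (simp add: card_Diff_subset)
    then have "aut_of_portrait k ?C \<in> H"
      using less(2,3) \<open>2 \<le> card B\<close> by (intro less(1)) auto
    moreover have "aut_of_portrait k {u, w} \<in> H" using pair uw less(2) by blast
    moreover have "(?C - {u, w}) \<union> ({u, w} - ?C) = B" using uw by blast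
    then have "aut_of_portrait k ?C \<circ> aut_of_portrait k {u, w} = aut_of_portrait k B"
      using portrait_comp_level[OF l, of ?C "{u, w}"] less(2) uw by auto
    ultimately show ?thesis using tree_aut_subgroup(3)[OF H] by metis
  qed
qed

section \<open>Parity homomorphisms\<close>

lemma level_child: "p \<in> tree_level l \<Longrightarrow> left_child p \<in> tree_level (Suc l) \<and> right_child p \<in> tree_level (Suc l)"
  by (cases p) (auto simp: mem_tree_level)

lemma child_inj:
  assumes "p \<in> tree_level l" "q \<in> tree_level l"
  shows "left_child p \<noteq> right_child q" "left_child p = left_child q \<longleftrightarrow> p = q"
    "right_child p = right_child q \<longleftrightarrow> p = q"
  using assms by (cases p; cases q; auto simp: mem_tree_level; presburger)+

lemma portrait_last_level:
  assumes A: "A \<subseteq> tree_level n" and u: "u \<in> tree_level n"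
  shows "aut_of_portrait (Suc n) A (left_child u) = (if u \<in> A then right_child u else left_child u)"
    "aut_of_portrait (Suc n) A (right_child u) = (if u \<in> A then left_child u else right_child u)"
proof -
  have A': "A \<subseteq> inner_vertices (Suc n)" and u': "u \<in> inner_vertices (Suc n)"
    using A u tree_level_subset_inner[of n "Suc n"] by auto
  have "aut_of_portrait (Suc n) A u = u"
    using portrait_fixes_above[OF _ A children_in_vertices(1)[OF u']] tree_level_fst[OF u] by simp
  then show "aut_of_portrait (Suc n) A (left_child u) = (if u \<in> A then right_child u else left_child u)"
    "aut_of_portrait (Suc n) A (right_child u) = (if u \<in> A then left_child u else right_child u)"
    using tree_auts_children[OF aut_of_portrait(1)[OF A'] u'] active_aut_of_portrait[OF A' u']
    by simp_all
qed

text \<open>Each active vertex of the last inner level contributes one transposition, that of its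
  two leaves.\<close>

lemma evenperm_portrait_last_level:
  assumes "A \<subseteq> tree_level n"
  shows "evenperm (restrict_id (aut_of_portrait (Suc n) A) (tree_level (Suc n))) \<longleftrightarrow> even (card A)"
  using finite_subset[OF assms finite_tree_level] assms
proof (induction A rule: finite_induct)
  case empty
  have "restrict_id id (tree_level (Suc n)) = id" by (auto simp: restrict_id_def)
  then show ?case by (simp add: portrait_empty)
next
  case (insert v A)
  let ?R = "\<lambda>B. restrict_id (aut_of_portrait (Suc n) B) (tree_level (Suc n))"
  have v: "v \<in> tree_level n" and A: "A \<subseteq> tree_level n" using insert.prems by auto
  have inner: "{v} \<subseteq> inner_vertices (Suc n)" "A \<subseteq> inner_vertices (Suc n)"
    using v A tree_level_subset_inner[of n "Suc n"] by auto
  have "({v} - A) \<union> (A - {v}) = insert v A" using insert.hyps by blast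
  then have "aut_of_portrait (Suc n) (insert v A)
      = aut_of_portrait (Suc n) {v} \<circ> aut_of_portrait (Suc n) A"
    using portrait_comp_level[of n "Suc n" "{v}" A] v A by simp
  then have "?R (insert v A) = ?R {v} \<circ> ?R A"
    using restrict_level_comp[OF aut_of_portrait(1)[OF inner(2)]] by simp
  moreover have "?R {v} = transpose (left_child v) (right_child v)"
  proof
    fix x
    show "?R {v} x = transpose (left_child v) (right_child v) x"
    proof (cases "x \<in> tree_level (Suc n)")
      case True
      obtain u where u: "u \<in> tree_level n" and x: "x = left_child u \<or> x = right_child u"
        using level_Suc_cases[OF True] .
      show ?thesis
        using x True portrait_last_level[of "{v}" n u] v u child_inj[OF u v] child_inj[OF v u]
        by (auto simp: transpose_def)
    next
      case False
      then show ?thesis using level_child[OF v] by (auto simp: transpose_def)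
    qed
  qed
  moreover have "evenperm (?R {v} \<circ> ?R A) \<longleftrightarrow> evenperm (?R {v}) = evenperm (?R A)"
    by (intro evenperm_comp restrict_level_permutation aut_of_portrait(1) inner)
  moreover have "left_child v \<noteq> right_child v" using child_inj(1)[OF v v] .
  ultimately have "evenperm (?R (insert v A)) \<longleftrightarrow> \<not> evenperm (?R A)"
    by (metis evenperm_swap)
  then show ?case using insert A by simp
qed

text \<open>The action on the right leaves is the action on the left leaves conjugated by the swap of all
  siblings, so the two have equal signs.\<close>

lemma evenperm_truncated:
  assumes g: "g \<in> truncated_auts (Suc n) n"
  shows "evenperm (restrict_id g (tree_level (Suc n)))"
proof -
  let ?L = "tree_level (Suc n)"
  let ?O = "left_child ` tree_level n"
  define c where "c = restrict_id (aut_of_portrait (Suc n) (tree_level n)) ?L"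
  define r where "r = restrict_id g ?O"
  have g': "g \<in> tree_auts (Suc n)" using g by (simp add: truncated_auts_iff)
  have inner: "tree_level n \<subseteq> inner_vertices (Suc n)" using tree_level_subset_inner by simp
  have gu: "g u \<in> tree_level n" "g (left_child u) = left_child (g u)"
    "g (right_child u) = right_child (g u)" if "u \<in> tree_level n" for u
    using tree_auts_in_level[OF g' _ that] tree_auts_children[OF g', of u] g that inner
      tree_level_fst[OF that] by (auto simp: truncated_auts_iff)
  have cu: "c (left_child u) = right_child u" "c (right_child u) = left_child u"
    if "u \<in> tree_level n" for u
    using portrait_last_level[of "tree_level n" n u] level_child[OF that] that by (simp_all add: c_def)
  have finO: "finite ?O" using finite_tree_level by blast
  have "g ` ?O \<subseteq> ?O" using gu by auto
  then have "g ` ?O = ?O"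
    using endo_inj_surj[OF finO] tree_auts_inj[OF g'] by (meson inj_on_subset subset_UNIV)
  then have "bij_betw g ?O ?O"
    using tree_auts_inj[OF g'] by (auto simp: bij_betw_def intro: inj_on_subset)
  then have "r permutes ?O" unfolding r_def by (rule permutes_restrict_id)
  then have pr: "permutation r" using finO unfolding permutation_permutes by blast
  have pc: "permutation c"
    unfolding c_def by (rule restrict_level_permutation[OF aut_of_portrait(1)[OF inner]])
  \<comment> \<open>\<open>r\<close> moves left leaves only, and
    \<open>c \<circ> (r \<circ> c)\<close> is its copy on the right leaves. As \<open>r\<close> and
    \<open>c\<close> occur twice each, the signs cancel.\<close>
  have "restrict_id g ?L = r \<circ> (c \<circ> (r \<circ> c))"
  proof
    fix x
    show "restrict_id g ?L x = (r \<circ> (c \<circ> (r \<circ> c))) x"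
    proof (cases "x \<in> ?L")
      case True
      obtain u where u: "u \<in> tree_level n" and x: "x = left_child u \<or> x = right_child u"
        using level_Suc_cases[OF True] .
      have r: "r (left_child v) = left_child (g v)" "r (right_child v) = right_child v"
        if "v \<in> tree_level n" for v
      proof -
        have "right_child v \<notin> ?O" using child_inj(1)[OF _ that] by (metis imageE)
        then show "r (left_child v) = left_child (g v)" "r (right_child v) = right_child v"
          using gu(2)[OF that] that by (simp_all add: r_def)
      qed
      show ?thesis
        using x r[OF u] r[OF gu(1)[OF u]] gu[OF u] cu[OF u] cu[OF gu(1)[OF u]] True by auto
    next
      case False
      then have "x \<notin> ?O" using level_child by blast
      then show ?thesis using False by (simp add: r_def c_def)
    qed
  qed
  then show ?thesis
    by (metis pr pc evenperm_comp permutation_compose)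
qed

text \<open>Once the labels on level \<open>n\<close> are cancelled by a portrait, the rest is even
  by \<open>evenperm_truncated\<close>; so \<open>g\<close> has the sign of that portrait, which
  counts the cancelled labels.\<close>

lemma evenperm_iff_active:
  assumes g: "g \<in> tree_auts (Suc n)"
  shows "evenperm (restrict_id g (tree_level (Suc n))) \<longleftrightarrow> even (card {v \<in> tree_level n. active g v})"
proof -
  let ?B = "{v \<in> tree_level n. active g v}"
  let ?T = "aut_of_portrait (Suc n) ?B"
  have B: "?B \<subseteq> tree_level n" by blast
  then have T: "?T \<in> tree_auts (Suc n)"
    using aut_of_portrait(1) tree_level_subset_inner[of n "Suc n"] by blast
  \<comment> \<open>Inner vertices end at level \<open>n\<close>, so every automorphism counts as
    truncated at \<open>Suc n\<close>.\<close>
  have "g \<in> truncated_auts (Suc n) (Suc n)"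
    using g by (auto simp: truncated_auts_iff inner_vertices_iff)
  then have "evenperm (restrict_id (g \<circ> ?T) (tree_level (Suc n)))"
    by (intro evenperm_truncated truncated_auts_remove_level) simp
  then show ?thesis
    using evenperm_portrait_last_level[OF B] restrict_level_comp[OF T]
      evenperm_comp[OF restrict_level_permutation[OF g] restrict_level_permutation[OF T]] by simp
qed

section \<open>Counts of active vertices modulo 2\<close>

lemma even_tree_auts_iff:
  assumes "1 \<le> k"
  shows "g \<in> even_tree_auts k \<longleftrightarrow>
    g \<in> tree_auts k \<and> even (card {v \<in> tree_level (k - 1). active g v})"
  using evenperm_iff_active[of g "k - 1"] assms by (auto simp: even_tree_auts_def)

text \<open>By the cocycle rule the active set of the product in \<open>M\<close> is a symmetric
  difference, with the labels of \<open>g\<close> read on the image of \<open>M\<close>. That image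
  is kept general because a level is invariant, while a half of it may be exchanged with the
  other.\<close>

lemma odd_card_active_comp:
  assumes g: "g \<in> tree_auts k" and h: "h \<in> tree_auts k" and M: "M \<subseteq> inner_vertices k"
  shows "odd (card {v \<in> M. active (g \<circ> h) v})
    \<longleftrightarrow> odd (card {v \<in> h ` M. active g v}) \<noteq> odd (card {v \<in> M. active h v})"
proof -
  define X where "X = {v \<in> M. active g (h v)}"
  define Y where "Y = {v \<in> M. active h v}"
  have "M \<subseteq> tree_vertices k" using M children_in_vertices(1) by blast
  then have "finite M" by (rule finite_subset[OF _ finite_tree_vertices])
  then have fin: "finite X" "finite Y" by (auto simp: X_def Y_def)
  have "active (g \<circ> h) v \<longleftrightarrow> active g (h v) \<noteq> active h v" if "v \<in> M" for v
    using active_comp[OF g h] M that by blast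
  then have "{v \<in> M. active (g \<circ> h) v} = (X - Y) \<union> (Y - X)"
    unfolding X_def Y_def by blast
  moreover have "card ((X - Y) \<union> (Y - X)) = card (X - Y) + card (Y - X)"
    using fin by (intro card_Un_disjoint) auto
  ultimately have n: "card {v \<in> M. active (g \<circ> h) v} = card (X - Y) + card (Y - X)" by simp
  have x: "card X = card (X - Y) + card (X \<inter> Y)"
    using card_Int_Diff[OF fin(1), of Y] by simp
  have y: "card Y = card (Y - X) + card (X \<inter> Y)"
    using card_Int_Diff[OF fin(2), of X] by (simp add: Int_commute)
  have "{v \<in> h ` M. active g v} = h ` X" by (auto simp: X_def)
  then have hX: "card {v \<in> h ` M. active g v} = card X"
    using tree_auts_inj[OF h] by (simp add: card_image inj_on_subset)
  \<comment> \<open>Used with \<open>a = card (X - Y)\<close>, \<open>b = card (Y - X)\<close>,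
    \<open>c = card (X \<inter> Y)\<close>: the overlap is counted twice and drops out modulo
    2.\<close>
  have "odd (a + b) \<longleftrightarrow> odd (a + c) \<noteq> odd (b + c)" for a b c :: nat by auto
  then show ?thesis unfolding n hX Y_def[symmetric] x y .
qed

text \<open>The halves are the subtrees below the two children of the root, so \<open>g\<close>
  keeps or exchanges them as wholes, and the image of \<open>(1, 1)\<close> tells which. Further
  down a vertex inherits its half from its parent.\<close>

lemma left_half_aut:
  assumes g: "g \<in> tree_auts k" and k: "1 \<le> k"
  shows "1 \<le> l \<Longrightarrow> l \<le> k \<Longrightarrow> v \<in> tree_level l \<Longrightarrow>
    left_half (g v) \<longleftrightarrow> (left_half v \<longleftrightarrow> left_half (g (1, 1)))"
proof (induction l arbitrary: v)
  case (Suc l)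
  show ?case
  proof (cases "l = 0")
    case True
    have lev: "(1, 1) \<in> tree_level 1" "(1, 2) \<in> tree_level 1" by (auto simp: mem_tree_level)
    have one: "w = (1, 1) \<or> w = (1, 2)" if "w \<in> tree_level 1" for w
      using that by (cases w) (auto simp: mem_tree_level)
    have "g (1, 1) \<noteq> g (1, 2)" using injD[OF tree_auts_inj[OF g]] by fastforce
    then show ?thesis
      using one[OF tree_auts_in_level[OF g k lev(1)]] one[OF tree_auts_in_level[OF g k lev(2)]]
        one[of v] Suc.prems True by (auto simp: left_half_def)
  next
    case False
    then have l: "1 \<le> l" "l < k" using Suc.prems by auto
    obtain p where p: "p \<in> tree_level l" and v: "v = left_child p \<or> v = right_child p"
      using level_Suc_cases[OF Suc.prems(3)] .
    have p': "p \<in> inner_vertices k" using p l tree_level_subset_inner by blast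
    have gp: "g p \<in> tree_level l" using tree_auts_in_level[OF g _ p] l by simp
    have "g v = left_child (g p) \<or> g v = right_child (g p)"
      using tree_auts_children[OF g p'] v by auto
    then have "left_half (g v) \<longleftrightarrow> left_half (g p)" using left_half_child[OF gp l(1)] by auto
    moreover have "left_half v \<longleftrightarrow> left_half p" using left_half_child[OF p l(1)] v by auto
    ultimately show ?thesis using Suc.IH[OF l(1) _ p] l by simp
  qed
qed simp

lemma tree_auts_image_level:
  assumes "g \<in> tree_auts k" "l \<le> k"
  shows "g ` tree_level l = tree_level l"
  using tree_auts_in_level[OF assms] tree_auts_inj[OF assms(1)]
  by (intro endo_inj_surj finite_tree_level) (auto intro: inj_on_subset)

lemma odd_card_active_level_comp:
  assumes "g \<in> tree_auts k" "h \<in> tree_auts k" "l < k"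
  shows "odd (card {v \<in> tree_level l. active (g \<circ> h) v})
    \<longleftrightarrow> odd (card {v \<in> tree_level l. active g v}) \<noteq> odd (card {v \<in> tree_level l. active h v})"
  using odd_card_active_comp[OF assms(1,2) tree_level_subset_inner[OF assms(3)]]
    tree_auts_image_level[OF assms(2), of l] assms(3) by simp

text \<open>An automorphism may exchange the two halves of the level, but for an even automorphism
  both halves contain equally many active vertices modulo 2.\<close>

lemma odd_card_active_left_half_comp:
  assumes g: "g \<in> even_tree_auts k" and h: "h \<in> even_tree_auts k" and k: "2 \<le> k"
  defines "L \<equiv> {v \<in> tree_level (k - 1). left_half v}"
  shows "odd (card {v \<in> L. active (g \<circ> h) v})
    \<longleftrightarrow> odd (card {v \<in> L. active g v}) \<noteq> odd (card {v \<in> L. active h v})"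
proof -
  let ?M = "tree_level (k - 1)"
  have gh: "g \<in> tree_auts k" "h \<in> tree_auts k" using g h by (auto simp: even_tree_auts_def)
  have L: "L \<subseteq> inner_vertices k" using tree_level_subset_inner[of "k - 1" k] k by (auto simp: L_def)
  have half: "left_half (h v) \<longleftrightarrow> (left_half v \<longleftrightarrow> left_half (h (1, 1)))" if "v \<in> ?M" for v
    using left_half_aut[OF gh(2), of "k - 1" v] k that by simp
  have hM: "h ` ?M = ?M" using tree_auts_image_level[OF gh(2)] by simp
  have hL: "h ` L = (if left_half (h (1, 1)) then L else ?M - L)"
  proof (rule Set.set_eqI)
    fix w
    have "w \<in> h ` L \<longleftrightarrow> w \<in> ?M \<and> left_half w = left_half (h (1, 1))"
    proof
      assume "w \<in> h ` L"
      then show "w \<in> ?M \<and> left_half w = left_half (h (1, 1))" using half hM by (auto simp: L_def)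
    next
      assume w: "w \<in> ?M \<and> left_half w = left_half (h (1, 1))"
      then obtain v where "v \<in> ?M" "w = h v" using hM by blast
      then show "w \<in> h ` L" using half[of v] w by (auto simp: L_def)
    qed
    then show "w \<in> h ` L \<longleftrightarrow> w \<in> (if left_half (h (1, 1)) then L else ?M - L)"
      by (auto simp: L_def)
  qed
  have "{v \<in> ?M. active g v} = {v \<in> L. active g v} \<union> {v \<in> ?M - L. active g v}"
    by (auto simp: L_def)
  then have "card {v \<in> ?M. active g v} = card {v \<in> L. active g v} + card {v \<in> ?M - L. active g v}"
    using card_Un_disjoint[of "{v \<in> L. active g v}" "{v \<in> ?M - L. active g v}"] finite_tree_level
    by (auto simp: L_def)
  moreover have "even (card {v \<in> ?M. active g v})" using g k by (simp add: even_tree_auts_iff)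
  ultimately have "odd (card {v \<in> h ` L. active g v}) = odd (card {v \<in> L. active g v})"
    unfolding hL by auto
  then show ?thesis using odd_card_active_comp[OF gh L] by simp
qed

text \<open>\<open>P\<close> is the nontrivial value of a homomorphism to Z/2; its kernel contains
  \<open>T\<close>, hence all that \<open>T\<close> generates, but not \<open>s\<close>.\<close>

lemma (in group) generate_neq_of_parity:
  assumes hom: "\<And>x y. x \<in> carrier G \<Longrightarrow> y \<in> carrier G \<Longrightarrow> P (x \<otimes> y) \<longleftrightarrow> P x \<noteq> P y"
    and T: "T \<subseteq> carrier G" "\<And>t. t \<in> T \<Longrightarrow> \<not> P t" and s: "s \<in> carrier G" "P s"
  shows "generate G T \<noteq> carrier G"
proof -
  have one: "\<not> P \<one>" using hom[of \<one> \<one>] by simp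
  have "\<not> P x" if "x \<in> generate G T" for x
    using that
  proof (induction rule: generate.induct)
    case (inv h)
    then show ?case using hom[of "inv h" h] T one by auto
  next
    case (eng h1 h2)
    then show ?case using hom[of h1 h2] generate_in_carrier[OF T(1)] by blast
  qed (use one T in auto)
  then show ?thesis using s by blast
qed

section \<open>The generating set\<close>

lemma even_tree_group_is_group: "group (even_tree_group k)"
  unfolding even_tree_group_def
  using group.subgroup_imp_group[OF tree_aut_group_is_group even_tree_auts_subgroup] .

text \<open>Brings both kinds of generators into one form, from which
  \<open>even_tree_auts_iff\<close> shows that they are even.\<close>

lemma S_beta_portraits:
  assumes k: "2 \<le> k" and s: "s \<in> S_beta k"
  obtains A l where "s = aut_of_portrait k A" "l < k" "A \<subseteq> tree_level l" "A \<subseteq> inner_vertices k"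
    "l = k - 1 \<Longrightarrow> even (card A)"
proof -
  consider j where "j \<le> k - 2" "s = beta k j" | "s = tau k" using s by (auto simp: S_beta_def)
  then show thesis
  proof cases
    case 1
    then have "j < k" "{(j, 1)} \<subseteq> tree_level j" using k by (auto simp: mem_tree_level)
    then show thesis
      using that[of "{(j, 1)}" j] 1 k tree_level_subset_inner[of j k] unfolding beta_def by auto
  next
    case 2
    \<comment> \<open>The two ends of level \<open>k - 1\<close> are distinct, so \<open>tau\<close>
      has two active vertices.\<close>
    have "2 ^ (k - 1) \<noteq> (1 :: nat)" using k by simp
    then have "card {(k - 1, 1), (k - 1, 2 ^ (k - 1) :: nat)} = 2"
      by (subst card_2_iff) fastforce
    moreover have "{(k - 1, 1), (k - 1, 2 ^ (k - 1))} \<subseteq> tree_level (k - 1)"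
      by (auto simp: mem_tree_level)
    ultimately show thesis
      using that[of "{(k - 1, 1), (k - 1, 2 ^ (k - 1))}" "k - 1"] 2 k tree_level_subset_inner[of "k - 1" k] unfolding tau_def by auto
  qed
qed

lemma S_beta_even:
  assumes k: "2 \<le> k"
  shows "S_beta k \<subseteq> even_tree_auts k"
proof
  fix s assume "s \<in> S_beta k"
  then obtain A l where A: "s = aut_of_portrait k A" "l < k" "A \<subseteq> tree_level l"
      "A \<subseteq> inner_vertices k" "l = k - 1 \<Longrightarrow> even (card A)"
    using S_beta_portraits[OF k] by metis
  have "active s v \<longleftrightarrow> v \<in> A" if "v \<in> tree_level (k - 1)" for v
    using active_aut_of_portrait[OF A(4), of v] tree_level_subset_inner[of "k - 1" k] that k A(1)
    by auto
  then have "{v \<in> tree_level (k - 1). active s v} = tree_level (k - 1) \<inter> A" by blast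
  also have "\<dots> = (if l = k - 1 then A else {})"
    using A(3) by (auto simp: tree_level_def)
  finally show "s \<in> even_tree_auts k" using A aut_of_portrait(1)[OF A(4)] k by (simp add: even_tree_auts_iff)
qed

lemma generate_S_beta:
  assumes k: "2 \<le> k"
  shows "generate (even_tree_group k) (S_beta k) = carrier (even_tree_group k)"
proof -
  let ?H = "generate (tree_aut_group k) (S_beta k)"
  let ?l = "k - 1"
  interpret G: group "tree_aut_group k" by (rule tree_aut_group_is_group)
  \<comment> \<open>Generation gives the same set in the even subgroup and in the full group, for
    which the lemmas on subgroups \<open>H\<close> are stated.\<close>
  have eq: "generate (even_tree_group k) (S_beta k) = ?H"
    unfolding even_tree_group_def
    by (rule G.generate_consistent[OF S_beta_even[OF k] even_tree_auts_subgroup])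
  have "S_beta k \<subseteq> carrier (tree_aut_group k)"
    using S_beta_even[OF k] subgroup.subset[OF even_tree_auts_subgroup] by blast
  then have H: "subgroup ?H (tree_aut_group k)" by (rule G.generate_is_subgroup)
  have l: "?l < k" "1 \<le> ?l" using k by auto
  have beta: "aut_of_portrait k {(j, 1)} \<in> ?H" if "j < ?l" for j
    using that by (intro generate.incl) (auto simp: S_beta_def beta_def)
  have tau: "aut_of_portrait k {(?l, 1), (?l, 2 ^ ?l)} \<in> ?H"
    by (intro generate.incl) (auto simp: S_beta_def tau_def)
  have trunc: "truncated_auts k ?l \<subseteq> ?H"
    using truncated_auts_subset_subgroup[OF H less_imp_le[OF l(1)]]
      single_portrait_in_subgroup[OF H l(1) beta] by blast
  \<comment> \<open>The upper levels come from the betas; on level \<open>k - 1\<close> an even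
    \<open>g\<close> has an even active set, which is composed of pairs obtained from
    \<open>tau\<close>.\<close>
  have "g \<in> ?H" if g: "g \<in> even_tree_auts k" for g
  proof (rule mem_subgroup_of_level[OF H l(1) _ trunc])
    have g': "g \<in> tree_auts k" "even (card {v \<in> tree_level ?l. active g v})"
      using g k by (simp_all add: even_tree_auts_iff)
    then show "g \<in> truncated_auts k (Suc ?l)"
      using k by (auto simp: truncated_auts_iff inner_vertices_iff)
    show "aut_of_portrait k {v \<in> tree_level ?l. active g v} \<in> ?H"
      using even_portrait_in_subgroup[OF H l(1)
          pair_portrait_in_subgroup[OF H l(2,1) trunc tau] _ g'(2)] by blast
  qed
  moreover have "?H \<subseteq> even_tree_auts k"
    by (rule G.generate_subgroup_incl[OF S_beta_even[OF k] even_tree_auts_subgroup])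
  ultimately show ?thesis unfolding eq by (auto simp: even_tree_group_def)
qed

text \<open>A proper subset misses some generator \<open>s\<close>, and for each \<open>s\<close>
  there is a parity that is odd on \<open>s\<close> and even on all other generators.\<close>

lemma S_beta_minimal:
  assumes k: "2 \<le> k" and T: "T \<subset> S_beta k"
  shows "generate (even_tree_group k) T \<noteq> carrier (even_tree_group k)"
proof -
  interpret E: group "even_tree_group k" by (rule even_tree_group_is_group)
  have carr: "carrier (even_tree_group k) = even_tree_auts k"
    and mult: "x \<otimes>\<^bsub>even_tree_group k\<^esub> y = x \<circ> y" for x y
    by (simp_all add: even_tree_group_def tree_aut_group_def)
  have sub: "even_tree_auts k \<subseteq> tree_auts k" by (auto simp: even_tree_auts_def)
  have TE: "T \<subseteq> carrier (even_tree_group k)" using T S_beta_even[OF k] carr by blast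
  have beta_active: "active (beta k j) v \<longleftrightarrow> v = (j, 1)"
    if "j \<le> k - 2" "v \<in> inner_vertices k" for j v
  proof -
    have "{(j, 1)} \<subseteq> inner_vertices k" using that k by (auto simp: mem_inner_vertices)
    then show ?thesis using active_aut_of_portrait that unfolding beta_def by blast
  qed
  have tau_active: "active (tau k) v \<longleftrightarrow> v = (k - 1, 1) \<or> v = (k - 1, 2 ^ (k - 1))"
    if "v \<in> inner_vertices k" for v
  proof -
    have "{(k - 1, 1), (k - 1, 2 ^ (k - 1))} \<subseteq> inner_vertices k"
      using k by (auto simp: mem_inner_vertices)
    then show ?thesis using active_aut_of_portrait that unfolding tau_def by blast
  qed
  obtain s where s: "s \<in> S_beta k" "s \<notin> T" using T by blast
  have sE: "s \<in> carrier (even_tree_group k)" using s S_beta_even[OF k] carr by blast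
  have lev: "v \<in> inner_vertices k" if "v \<in> tree_level l" "l < k" for v l
    using tree_level_subset_inner that by blast
  consider l where "l \<le> k - 2" "s = beta k l" | "s = tau k" using s by (auto simp: S_beta_def)
  then show ?thesis
  proof cases
    case 1
    then have l: "l < k" "l \<noteq> k - 1" using k by auto
    \<comment> \<open>Among the generators only \<open>beta k l\<close> is active anywhere on level
      \<open>l\<close>, and there at a single vertex.\<close>
    define P where "P g \<longleftrightarrow> odd (card {v \<in> tree_level l. active g v})" for g
    show ?thesis
    proof (rule E.generate_neq_of_parity[of P, OF _ TE _ sE])
      fix x y assume "x \<in> carrier (even_tree_group k)" "y \<in> carrier (even_tree_group k)"
      then show "P (x \<otimes>\<^bsub>even_tree_group k\<^esub> y) \<longleftrightarrow> P x \<noteq> P y"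
        using odd_card_active_level_comp[OF _ _ l(1)] sub unfolding carr mult P_def by blast
    next
      fix t assume t: "t \<in> T"
      then have "t \<in> S_beta k" "t \<noteq> s" using T s by auto
      from \<open>t \<in> S_beta k\<close> have "t = tau k \<or> (\<exists>j\<le>k - 2. t = beta k j)"
        by (auto simp: S_beta_def)
      with \<open>t \<noteq> s\<close> consider j where "j \<le> k - 2" "t = beta k j" "j \<noteq> l" | "t = tau k"
        using 1(2) by blast
      then have inactive: "{v \<in> tree_level l. active t v} = {}"
      proof cases
        case j: 1
        have "\<not> active t v" if "v \<in> tree_level l" for v
          using beta_active[OF j(1) lev[OF that l(1)]] tree_level_fst[OF that] j by auto
        then show ?thesis by blast
      next
        case 2
        have "\<not> active t v" if "v \<in> tree_level l" for v
          using tau_active[OF lev[OF that l(1)]] tree_level_fst[OF that] 2 l by auto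
        then show ?thesis by blast
      qed
      show "\<not> P t" unfolding P_def inactive by simp
    next
      have "{v \<in> tree_level l. active s v} = {(l, 1)}"
        using beta_active[OF 1(1)] lev[OF _ l(1)] 1(2) by (auto simp: mem_tree_level)
      then show "P s" by (simp add: P_def)
    qed
  next
    case 2
    \<comment> \<open>Only one half is counted: \<open>tau\<close> has one active vertex in each, so
      the whole level would give an even number.\<close>
    define L where "L = {v \<in> tree_level (k - 1). left_half v}"
    have L: "v \<in> inner_vertices k" "fst v = k - 1" if "v \<in> L" for v
      using that lev[of v "k - 1"] k tree_level_fst by (auto simp: L_def)
    define P where "P g \<longleftrightarrow> odd (card {v \<in> L. active g v})" for g
    show ?thesis
    proof (rule E.generate_neq_of_parity[of P, OF _ TE _ sE])
      fix x y assume "x \<in> carrier (even_tree_group k)" "y \<in> carrier (even_tree_group k)"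
      then show "P (x \<otimes>\<^bsub>even_tree_group k\<^esub> y) \<longleftrightarrow> P x \<noteq> P y"
        using odd_card_active_left_half_comp[OF _ _ k] unfolding carr mult P_def L_def by simp
    next
      fix t assume t: "t \<in> T"
      then have "t \<in> S_beta k" "t \<noteq> tau k" using T s 2 by auto
      then obtain j where j: "j \<le> k - 2" "t = beta k j" unfolding S_beta_def by auto
      then have inactive: "{v \<in> L. active t v} = {}" using beta_active[OF j(1)] L k by fastforce
      show "\<not> P t" unfolding P_def inactive by simp
    next
      \<comment> \<open>This makes the subtractions in the exponents exact: level
        \<open>k - 1\<close> ends at position \<open>2 ^ Suc n\<close>, its left half at
        \<open>2 ^ n\<close>.\<close>
      obtain n where n: "k = Suc (Suc n)" using k by (metis add_2_eq_Suc le_Suc_ex)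
      have "(k - 1, 1) \<in> L" "(k - 1, 2 ^ (k - 1)) \<notin> L"
        by (auto simp: L_def mem_tree_level left_half_def n)
      then have "{v \<in> L. active s v} = {(k - 1, 1)}"
        using tau_active L(1) 2 by blast
      then show "P s" by (simp add: P_def)
    qed
  qed
qed

section \<open>Embedding into the alternating group\<close>

lemma finite_inner_vertices: "finite (inner_vertices k)"
  by (simp add: inner_vertices_def finite_tree_level)

lemma card_inner_vertices: "Suc (card (inner_vertices k)) = 2 ^ k"
proof (induction k)
  case (Suc k)
  have "inner_vertices (Suc k) = inner_vertices k \<union> tree_level k"
    by (auto simp: inner_vertices_def less_Suc_eq)
  moreover have "inner_vertices k \<inter> tree_level k = {}" by (auto simp: inner_vertices_def tree_level_def)
  ultimately have "card (inner_vertices (Suc k)) = card (inner_vertices k) + card (tree_level k)"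
    by (simp add: card_Un_disjoint finite_inner_vertices finite_tree_level)
  then show ?case using Suc by (simp add: tree_level_def)
qed (simp add: inner_vertices_def)

lemma bij_betw_portraits: "bij_betw (active_vertices k) (tree_auts k) (Pow (inner_vertices k))"
proof -
  have "A \<in> active_vertices k ` tree_auts k" if "A \<subseteq> inner_vertices k" for A
    using aut_of_portrait[OF that] by (metis imageI)
  then show ?thesis
    by (auto simp: bij_betw_def inj_on_def intro: portrait_inj) (auto simp: active_vertices_def)
qed

lemma card_tree_auts: "finite (tree_auts k)" "card (tree_auts k) = 2 ^ (2 ^ k - 1)"
proof -
  show "finite (tree_auts k)"
    using bij_betw_finite[OF bij_betw_portraits] finite_inner_vertices by simp
  have "card (tree_auts k) = 2 ^ card (inner_vertices k)"
    using bij_betw_same_card[OF bij_betw_portraits] by (simp add: card_Pow finite_inner_vertices)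
  then show "card (tree_auts k) = 2 ^ (2 ^ k - 1)"
    using card_inner_vertices[of k] by (metis diff_Suc_1)
qed

text \<open>Right multiplication by an involution with one active vertex on level
  \<open>k - 1\<close> exchanges even and odd automorphisms, so the even ones make up half.\<close>

lemma card_even_tree_auts:
  assumes k: "1 \<le> k"
  shows "card (even_tree_auts k) = 2 ^ (2 ^ k - 2)"
proof -
  let ?t = "aut_of_portrait k {(k - 1, 1)}"
  let ?E = "even_tree_auts k"
  let ?odd = "\<lambda>g. odd (card {v \<in> tree_level (k - 1). active g v})"
  have A: "{(k - 1, 1)} \<subseteq> tree_level (k - 1)" "{(k - 1, 1)} \<subseteq> inner_vertices k"
    using k by (auto simp: mem_tree_level mem_inner_vertices)
  have l: "k - 1 < k" using k by simp
  note t = aut_of_portrait(1)[OF A(2)]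
  have "{v \<in> tree_level (k - 1). active ?t v} = {(k - 1, 1)}"
    using active_aut_of_portrait[OF A(2)] tree_level_subset_inner[OF l] A by blast
  then have todd: "?odd ?t" by simp
  have E: "g \<in> ?E \<longleftrightarrow> g \<in> tree_auts k \<and> \<not> ?odd g" for g using even_tree_auts_iff[OF k] by simp
  have comp: "g \<circ> ?t \<in> tree_auts k \<and> (?odd (g \<circ> ?t) \<longleftrightarrow> \<not> ?odd g)" if "g \<in> tree_auts k" for g
    using tree_auts_comp[OF that t] odd_card_active_level_comp[OF that t l] todd by blast
  have tt: "g \<circ> ?t \<circ> ?t = g" for g
    using portrait_level_involution[OF l A(1)] by (simp add: comp_assoc)
  have "bij_betw (\<lambda>g. g \<circ> ?t) ?E (tree_auts k - ?E)"
    by (rule bij_betw_byWitness[where f' = "\<lambda>g. g \<circ> ?t"]) (use tt comp E in blast)+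
  then have "card (tree_auts k - ?E) = card ?E" by (rule bij_betw_same_card[symmetric])
  moreover have "?E \<subseteq> tree_auts k" using E by blast
  then have "card (tree_auts k - ?E) = card (tree_auts k) - card ?E" "card ?E \<le> card (tree_auts k)"
    using card_tree_auts(1) by (auto simp: card_Diff_subset finite_subset card_mono)
  ultimately have "2 * card ?E = 2 ^ (2 ^ k - 1)" using card_tree_auts(2) by simp
  moreover have "(2::nat) ^ 1 \<le> 2 ^ k" using k by (intro power_increasing) auto
  then have "2 ^ k - 1 = Suc (2 ^ k - 2 :: nat)" by simp
  ultimately show ?thesis by simp
qed

section \<open>The power of 2 in the order of the alternating group\<close>

text \<open>Each of the \<open>m\<close> even factors up to \<open>2 * m\<close> gives one factor 2,
  and halving them leaves \<open>fact m\<close>; odd factors contribute nothing.\<close>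

lemma multiplicity_two_fact_double:
  "multiplicity 2 (fact (2 * m) :: nat) = m + multiplicity 2 (fact m :: nat)"
proof (induction m)
  case (Suc m)
  have "fact (2 * Suc m) = (2 * Suc m) * ((2 * m + 1) * fact (2 * m) :: nat)" by (simp add: algebra_simps)
  then have "multiplicity 2 (fact (2 * Suc m) :: nat)
      = multiplicity 2 (2 * Suc m) + (multiplicity 2 (2 * m + 1) + multiplicity 2 (fact (2 * m) :: nat))"
    by (simp add: prime_elem_multiplicity_mult_distrib del: mult_Suc_right mult_Suc)
  moreover have "multiplicity 2 (2 * m + 1) = 0" by (intro not_dvd_imp_multiplicity_0) simp
  moreover have "multiplicity 2 (2 * Suc m) = Suc (multiplicity 2 (Suc m))"
    by (rule multiplicity_times_same) auto
  moreover have "multiplicity 2 (fact (Suc m) :: nat) = multiplicity 2 (Suc m) + multiplicity 2 (fact m :: nat)"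
    by (simp add: prime_elem_multiplicity_mult_distrib del: mult_Suc)
  ultimately show ?case using Suc by simp
qed simp

lemma multiplicity_two_fact_power: "Suc (multiplicity 2 (fact (2 ^ k) :: nat)) = 2 ^ k"
proof (induction k)
  case (Suc k)
  then show ?case using multiplicity_two_fact_double[of "2 ^ k"] by simp
qed simp

text \<open>On at least two points the alternating group has index 2, which costs one factor 2 of
  the factorial.\<close>

lemma multiplicity_two_order_alt_group:
  assumes "1 \<le> k"
  shows "multiplicity 2 (order (alt_group (2 ^ k))) = 2 ^ k - 2"
proof -
  have "(2::nat) ^ 1 \<le> 2 ^ k" using assms by (intro power_increasing) auto
  then have *: "2 * order (alt_group (2 ^ k)) = fact (2 ^ k)"
    using alt_group_card_carrier by (simp add: order_def)
  then have "order (alt_group (2 ^ k)) \<noteq> 0" by (metis fact_nonzero mult_0_right)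
  with * have "Suc (multiplicity 2 (order (alt_group (2 ^ k)))) = multiplicity 2 (fact (2 ^ k) :: nat)"
    using multiplicity_times_same[where p = 2 and x = "order (alt_group (2 ^ k))"] by simp
  then show ?thesis using multiplicity_two_fact_power[of k] by simp
qed

section \<open>The faithful action on the numbered leaves\<close>

text \<open>Agreement climbs from the leaves to the root, because the image of a vertex is the
  parent of the image of its left child.\<close>

lemma tree_auts_eq_of_leaves:
  assumes g: "g \<in> tree_auts k" and h: "h \<in> tree_auts k"
    and leaves: "\<And>v. v \<in> tree_level k \<Longrightarrow> g v = h v"
  shows "g = h"
proof
  fix v
  have "l \<le> k \<Longrightarrow> \<forall>v\<in>tree_level l. g v = h v" for l
  proof (induction rule: inc_induct)
    case (step l)
    show ?case
    proof
      fix v assume v: "v \<in> tree_level l"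
      have v': "v \<in> inner_vertices k" using v step tree_level_subset_inner by blast
      have c: "left_child v \<in> tree_vertices k" "0 < fst (left_child v)" "tree_parent (left_child v) = v"
        using v children_in_vertices(2)[OF v'] by (cases v; auto simp: mem_tree_level)+
      have "g (left_child v) = h (left_child v)" using step.IH level_child[OF v] by blast
      then show "g v = h v"
        using tree_auts_level_parent[OF g c(1)] tree_auts_level_parent[OF h c(1)] c by simp
    qed
  qed (use leaves in blast)
  then show "g v = h v"
    using g h by (cases "v \<in> tree_vertices k") (auto simp: tree_auts_def permutes_not_in tree_vertices_def)
qed

text \<open>Leaves are renamed by their positions, since \<open>alt_group (2 ^ k)\<close> permutes
  the numbers from 1 to \<open>2 ^ k\<close>.\<close>

definition leaf_perm :: "nat \<Rightarrow> (vertex \<Rightarrow> vertex) \<Rightarrow> nat \<Rightarrow> nat" where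
  "leaf_perm k g = map_permutation (tree_level k) snd (restrict_id g (tree_level k))"

lemma snd_bij_betw_level: "bij_betw snd (tree_level k) {1..2 ^ k}"
  by (auto simp: bij_betw_def inj_on_def tree_level_def)

lemma leaf_perm_permutes: "g \<in> tree_auts k \<Longrightarrow> leaf_perm k g permutes {1..2 ^ k}"
  unfolding leaf_perm_def
  by (rule map_permutation_permutes[OF snd_bij_betw_level restrict_level_permutes(1)])

lemma leaf_perm_apply: "v \<in> tree_level k \<Longrightarrow> leaf_perm k g (snd v) = snd (g v)"
  unfolding leaf_perm_def
  by (subst map_permutation_apply[OF bij_betw_imp_inj_on[OF snd_bij_betw_level]]) simp_all

lemma evenperm_leaf_perm:
  "g \<in> tree_auts k \<Longrightarrow> evenperm (leaf_perm k g) \<longleftrightarrow> evenperm (restrict_id g (tree_level k))"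
  unfolding leaf_perm_def
  by (rule evenperm_map_permutation[OF bij_betw_imp_inj_on[OF snd_bij_betw_level]
        restrict_level_permutes(1) finite_tree_level])

lemma leaf_perm_comp:
  assumes g: "g \<in> tree_auts k" and h: "h \<in> tree_auts k"
  shows "leaf_perm k (g \<circ> h) = leaf_perm k g \<circ> leaf_perm k h"
proof
  fix i
  show "leaf_perm k (g \<circ> h) i = (leaf_perm k g \<circ> leaf_perm k h) i"
  proof (cases "i \<in> {1..2 ^ k}")
    case True
    then obtain v where v: "v \<in> tree_level k" "i = snd v"
      using bij_betw_imp_surj_on[OF snd_bij_betw_level] by blast
    then show ?thesis using restrict_level_permutes(2)[OF h] by (simp add: leaf_perm_apply)
  next
    case False
    then show ?thesis
      using g[THEN leaf_perm_permutes] h[THEN leaf_perm_permutes]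
        tree_auts_comp[OF g h, THEN leaf_perm_permutes] by (metis comp_apply permutes_not_in)
  qed
qed

lemma leaf_perm_inj: "inj_on (leaf_perm k) (tree_auts k)"
proof (rule inj_onI)
  fix g h assume gh: "g \<in> tree_auts k" "h \<in> tree_auts k" and eq: "leaf_perm k g = leaf_perm k h"
  show "g = h"
  proof (rule tree_auts_eq_of_leaves[OF gh])
    fix v assume v: "v \<in> tree_level k"
    have "snd (g v) = snd (h v)" using eq leaf_perm_apply[OF v] by metis
    moreover have "fst (g v) = fst (h v)"
      using gh[THEN restrict_level_permutes(2)] v tree_level_fst by metis
    ultimately show "g v = h v" by (rule prod_eqI[rotated])
  qed
qed

text \<open>The Sylow subgroup is the image of the action on the leaves, an injective homomorphism
  into the alternating group; the number of even automorphisms is the full power of 2 in the order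
  of that group.\<close>

lemma even_tree_group_iso_sylow:
  assumes k: "1 \<le> k"
  shows "\<exists>P. sylow_subgroup 2 (alt_group (2 ^ k)) P \<and>
    even_tree_group k \<cong> (alt_group (2 ^ k))\<lparr>carrier := P\<rparr>"
proof (intro exI conjI)
  let ?E = "even_tree_group k" and ?A = "alt_group (2 ^ k)"
  let ?P = "leaf_perm k ` even_tree_auts k"
  have carr: "carrier ?E = even_tree_auts k" and mult: "x \<otimes>\<^bsub>?E\<^esub> y = x \<circ> y" for x y
    by (simp_all add: even_tree_group_def tree_aut_group_def)
  have sub: "even_tree_auts k \<subseteq> tree_auts k" by (auto simp: even_tree_auts_def)
  have "leaf_perm k g \<in> carrier ?A" if "g \<in> even_tree_auts k" for g
    using that leaf_perm_permutes[of g k] evenperm_leaf_perm[of g k]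
    unfolding alt_group_carrier even_tree_auts_def by simp
  then have hom: "leaf_perm k \<in> hom ?E ?A"
    using leaf_perm_comp[OF subsetD[OF sub] subsetD[OF sub]]
    by (intro homI) (simp_all add: carr mult alt_group_mult)
  interpret group_hom ?E ?A "leaf_perm k"
    using hom even_tree_group_is_group alt_group_is_group by (simp add: group_hom_def group_hom_axioms_def)
  have inj: "inj_on (leaf_perm k) (even_tree_auts k)" using leaf_perm_inj sub by (rule inj_on_subset)
  have "leaf_perm k \<in> iso ?E (?A\<lparr>carrier := ?P\<rparr>)"
    using inj hom by (auto simp: iso_def hom_def bij_betw_def carr)
  then show "?E \<cong> ?A\<lparr>carrier := ?P\<rparr>" by (rule is_isoI)
  have "subgroup ?P ?A" using img_is_subgroup carr by simp
  moreover have "card ?P = 2 ^ (2 ^ k - 2)" using card_image[OF inj] card_even_tree_auts[OF k] by simp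
  moreover have "finite (carrier ?A)"
    by (rule finite_subset[OF _ finite_permutations[of "{1..2 ^ k}"]]) (auto simp: alt_group_carrier)
  ultimately show "sylow_subgroup 2 ?A ?P"
    by (simp add: sylow_subgroup_def multiplicity_two_order_alt_group[OF k])
qed

theorem mainTheorem1:
  fixes k :: nat
  assumes "k \<ge> 2"
  shows "minimal_generating_set (even_tree_group k) (S_beta k) \<and>
    (\<exists>P. sylow_subgroup 2 (alt_group (2 ^ k)) P \<and>
         even_tree_group k \<cong> (alt_group (2 ^ k))\<lparr>carrier := P\<rparr>)"
proof -
  have "carrier (even_tree_group k) = even_tree_auts k" by (simp add: even_tree_group_def)
  then have "minimal_generating_set (even_tree_group k) (S_beta k)"
    using S_beta_even[OF assms] generate_S_beta[OF assms] S_beta_minimal[OF assms]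
    unfolding minimal_generating_set_def by blast
  then show ?thesis using even_tree_group_iso_sylow assms by simp
qed

end
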